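(* Let $G=(V,E)$ be a $3$-connected simple $(2,1)$-circuit with minimum degree $\delta(G)=3$ that is not isomorphic to any graph in the set $\mathcal{G}$. Suppose either (i) $G$ is essentially 5-edge-connected and there is no proper critical set in $G$; or (ii) $G$ is essentially 4-edge-connected and there is a proper critical set in $G$. Then $G$ contains an admissible node.
   Context: All graphs are finite. For a graph $G=(V,E)$ and $X\subseteq V$, $i_G(X)$ (or $i(X)$) is the number of edges induced by $X$. A simple graph $G=(V,E)$ is a (simple) $(2,1)$-circuit if $|E|=2|V|$ and $i_G(X)\le 2|X|-1$ for all nonempty $X\subsetneq V$. In a $(2,1)$-circuit $G$, a set $X\subsetneq V$ is critical if $i(X)=2|X|-1$; a critical set is proper if $|X|<|V|-1$. A $k$-edge-cutset is a set of $k$ edges whose removal disconnects the graph; it is trivial if one of the resulting components consists of a single vertex, and non-trivial otherwise. A graph is essentially $k$-edge-connected if it has no non-trivial $(k-1)$-edge-cutset. A node is a vertex of degree three. A 1-reduction at a node $v$ deletes $v$ and adds an edge between two of its neighbours. A node $v$ is admissible if there is a 1-reduction removing $v$ that results in a $(2,1)$-circuit and in which the added edge is between previously non-adjacent vertices (so the resulting circuit is again simple). $\mathcal{G}=\{K_5,\overline{G57},\overline{G59},\overline{G293},\overline{G308},\overline{G312},S_1,S_2,S_3,S_4,S_5\}$ where: $\overline{G57}$ is $K_6$ minus the edges of a triangle; $\overline{G59}$ is $K_6$ minus the edges of a path with three edges; $\overline{G293}$ is the join of $K_2$ with the disjoint union of a path on three vertices and a $K_2$; $\overline{G308}$ has vertices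 $c,u,p,q,r,s,t$, and its edges are those of the complete graphs on $\{c,u,p,q\}$ and on $\{c,r,s,t\}$ together with $ur,us$; $\overline{G312}$ has vertices $c,p_1,p_2,p_3,q_1,q_2,q_3$, and its edges are those of the complete graphs on $\{c,p_1,p_2,p_3\}$ and on $\{c,q_1,q_2,q_3\}$ together with $p_1q_1,p_2q_2$; each of $S_1,\dots,S_4$ consists of two disjoint complete graphs on $\{p_1,p_2,p_3,p_4\}$ and $\{q_1,q_2,q_3,q_4\}$ together with four further edges, namely $S_1$: $p_1q_1,p_2q_2,p_3q_3,p_4q_4$; $S_2$: $p_1q_1,p_1q_2,p_2q_3,p_2q_4$; $S_3$: $p_1q_1,p_1q_2,p_2q_1,p_2q_2$; $S_4$: $p_1q_1,p_1q_2,p_2q_2,p_2q_3$; $S_5$ is the union of the complete graph on $\{c,p_1,\dots,p_4\}$ minus the edge $cp_1$ and the complete graph on $\{c,q_1,\dots,q_4\}$ minus the edge $q_1q_2$. *)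

theory Defs
  imports Main
begin

text \<open>A graph is a pair of a vertex set and a set of edges, an edge being the set of its two ends.\<close>

type_synonym 'a ugraph = "'a set \<times> 'a set set"

abbreviation vertices :: "'a ugraph \<Rightarrow> 'a set" where
  "vertices G \<equiv> fst G"

abbreviation edges :: "'a ugraph \<Rightarrow> 'a set set" where
  "edges G \<equiv> snd G"

definition pairs_of :: "'a set \<Rightarrow> 'a set set" where
  "pairs_of A = {e. e \<subseteq> A \<and> card e = 2}"

definition finite_simple_graph :: "'a ugraph \<Rightarrow> bool" where
  "finite_simple_graph G \<longleftrightarrow> finite (vertices G) \<and> edges G \<subseteq> pairs_of (vertices G)"

definition degree :: "'a ugraph \<Rightarrow> 'a \<Rightarrow> nat" where
  "degree G v = card {e \<in> edges G. v \<in> e}"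

definition min_degree :: "'a ugraph \<Rightarrow> nat" where
  "min_degree G = Min (degree G ` vertices G)"

definition adj_rel :: "'a ugraph \<Rightarrow> 'a rel" where
  "adj_rel G = {(x, y). {x, y} \<in> edges G}"

definition component_of :: "'a ugraph \<Rightarrow> 'a \<Rightarrow> 'a set" where
  "component_of G x = {y \<in> vertices G. (x, y) \<in> (adj_rel G)\<^sup>*}"

definition connected_graph :: "'a ugraph \<Rightarrow> bool" where
  "connected_graph G \<longleftrightarrow>
     vertices G \<noteq> {} \<and> (\<forall>x \<in> vertices G. \<forall>y \<in> vertices G. (x, y) \<in> (adj_rel G)\<^sup>*)"

definition delete_vertices :: "'a ugraph \<Rightarrow> 'a set \<Rightarrow> 'a ugraph" where
  "delete_vertices G X = (vertices G - X, {e \<in> edges G. e \<inter> X = {}})"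

definition delete_edges :: "'a ugraph \<Rightarrow> 'a set set \<Rightarrow> 'a ugraph" where
  "delete_edges G F = (vertices G, edges G - F)"

definition k_connected :: "nat \<Rightarrow> 'a ugraph \<Rightarrow> bool" where
  "k_connected k G \<longleftrightarrow> k < card (vertices G) \<and>
     (\<forall>X \<subseteq> vertices G. card X < k \<longrightarrow> connected_graph (delete_vertices G X))"

definition edge_cutset :: "nat \<Rightarrow> 'a ugraph \<Rightarrow> 'a set set \<Rightarrow> bool" where
  "edge_cutset k G F \<longleftrightarrow>
     F \<subseteq> edges G \<and> card F = k \<and> \<not> connected_graph (delete_edges G F)"

definition trivial_cutset :: "'a ugraph \<Rightarrow> 'a set set \<Rightarrow> bool" where
  "trivial_cutset G F \<longleftrightarrow> (\<exists>v \<in> vertices G. component_of (delete_edges G F) v = {v})"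

definition essentially_edge_connected :: "nat \<Rightarrow> 'a ugraph \<Rightarrow> bool" where
  "essentially_edge_connected k G \<longleftrightarrow>
     \<not> (\<exists>j F. k = j + 1 \<and> edge_cutset j G F \<and> \<not> trivial_cutset G F)"

definition induced_edge_count :: "'a ugraph \<Rightarrow> 'a set \<Rightarrow> nat" where
  "induced_edge_count G X = card {e \<in> edges G. e \<subseteq> X}"

text \<open>The bounds involving \<open>2|X| - 1\<close> and \<open>|V| - 1\<close> are written additively below, because
  subtraction on \<^typ>\<open>nat\<close> truncates: with it the empty set would count as critical.\<close>

definition simple_circuit21 :: "'a ugraph \<Rightarrow> bool" where
  "simple_circuit21 G \<longleftrightarrow> finite_simple_graph G \<and>
     card (edges G) = 2 * card (vertices G) \<and>
     (\<forall>X. X \<noteq> {} \<and> X \<subset> vertices G \<longrightarrow> induced_edge_count G X + 1 \<le> 2 * card X)"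

definition critical :: "'a ugraph \<Rightarrow> 'a set \<Rightarrow> bool" where
  "critical G X \<longleftrightarrow> X \<subset> vertices G \<and> induced_edge_count G X + 1 = 2 * card X"

definition proper_critical :: "'a ugraph \<Rightarrow> 'a set \<Rightarrow> bool" where
  "proper_critical G X \<longleftrightarrow> critical G X \<and> card X + 1 < card (vertices G)"

definition node :: "'a ugraph \<Rightarrow> 'a \<Rightarrow> bool" where
  "node G v \<longleftrightarrow> v \<in> vertices G \<and> degree G v = 3"

definition one_reduction :: "'a ugraph \<Rightarrow> 'a \<Rightarrow> 'a \<Rightarrow> 'a \<Rightarrow> 'a ugraph" where
  "one_reduction G v x y =
     (vertices G - {v}, insert {x, y} (edges (delete_vertices G {v})))"

definition admissible :: "'a ugraph \<Rightarrow> 'a \<Rightarrow> bool" where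
  "admissible G v \<longleftrightarrow> node G v \<and>
     (\<exists>x y. x \<noteq> y \<and> {v, x} \<in> edges G \<and> {v, y} \<in> edges G \<and> {x, y} \<notin> edges G \<and>
            simple_circuit21 (one_reduction G v x y))"

definition graph_iso :: "'a ugraph \<Rightarrow> 'b ugraph \<Rightarrow> bool" where
  "graph_iso G H \<longleftrightarrow> (\<exists>f. bij_betw f (vertices G) (vertices H) \<and>
     (\<forall>x \<in> vertices G. \<forall>y \<in> vertices G. {x, y} \<in> edges G \<longleftrightarrow> {f x, f y} \<in> edges H))"

definition complete_graph :: "'a set \<Rightarrow> 'a ugraph" where
  "complete_graph A = (A, pairs_of A)"

definition graph_union :: "'a ugraph \<Rightarrow> 'a ugraph \<Rightarrow> 'a ugraph" where
  "graph_union G H = (vertices G \<union> vertices H, edges G \<union> edges H)"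

text \<open>Only meant for graphs with disjoint vertex sets.\<close>

definition graph_join :: "'a ugraph \<Rightarrow> 'a ugraph \<Rightarrow> 'a ugraph" where
  "graph_join G H = (vertices G \<union> vertices H,
     edges G \<union> edges H \<union> {{x, y} | x y. x \<in> vertices G \<and> y \<in> vertices H})"

definition add_edges :: "'a ugraph \<Rightarrow> 'a set set \<Rightarrow> 'a ugraph" where
  "add_edges G F = (vertices G, edges G \<union> F)"

datatype vname = Vc | Vu | Vp | Vq | Vr | Vs | Vt | P nat | Q nat

definition K5 :: "vname ugraph" where
  "K5 = complete_graph (P ` {1..5})"

definition G57 :: "vname ugraph" where
  "G57 = delete_edges (complete_graph (P ` {1..6})) {{P 1, P 2}, {P 2, P 3}, {P 1, P 3}}"

definition G59 :: "vname ugraph" where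
  "G59 = delete_edges (complete_graph (P ` {1..6})) {{P 1, P 2}, {P 2, P 3}, {P 3, P 4}}"

definition G293 :: "vname ugraph" where
  "G293 = graph_join (complete_graph {Q 1, Q 2})
     (graph_union ({P 1, P 2, P 3}, {{P 1, P 2}, {P 2, P 3}}) (complete_graph {P 4, P 5}))"

definition G308 :: "vname ugraph" where
  "G308 = add_edges
     (graph_union (complete_graph {Vc, Vu, Vp, Vq}) (complete_graph {Vc, Vr, Vs, Vt}))
     {{Vu, Vr}, {Vu, Vs}}"

definition G312 :: "vname ugraph" where
  "G312 = add_edges
     (graph_union (complete_graph {Vc, P 1, P 2, P 3}) (complete_graph {Vc, Q 1, Q 2, Q 3}))
     {{P 1, Q 1}, {P 2, Q 2}}"

definition two_K4 :: "vname ugraph" where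
  "two_K4 = graph_union (complete_graph (P ` {1..4})) (complete_graph (Q ` {1..4}))"

definition S1 :: "vname ugraph" where
  "S1 = add_edges two_K4 {{P 1, Q 1}, {P 2, Q 2}, {P 3, Q 3}, {P 4, Q 4}}"

definition S2 :: "vname ugraph" where
  "S2 = add_edges two_K4 {{P 1, Q 1}, {P 1, Q 2}, {P 2, Q 3}, {P 2, Q 4}}"

definition S3 :: "vname ugraph" where
  "S3 = add_edges two_K4 {{P 1, Q 1}, {P 1, Q 2}, {P 2, Q 1}, {P 2, Q 2}}"

definition S4 :: "vname ugraph" where
  "S4 = add_edges two_K4 {{P 1, Q 1}, {P 1, Q 2}, {P 2, Q 2}, {P 2, Q 3}}"

definition S5 :: "vname ugraph" where
  "S5 = graph_union
     (delete_edges (complete_graph (insert Vc (P ` {1..4}))) {{Vc, P 1}})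
     (delete_edges (complete_graph (insert Vc (Q ` {1..4}))) {{Q 1, Q 2}})"

definition exceptional_graphs :: "vname ugraph set" where
  "exceptional_graphs = {K5, G57, G59, G293, G308, G312, S1, S2, S3, S4, S5}"

end

theory Submission
  imports Defs
begin

text \<open>
  For a set \<open>X\<close> of vertices let the slack be \<open>f X = 2 |X| - i X\<close>. In a circuit \<open>f\<close> is at
  least 1 on nonempty proper subsets of the vertex set \<open>V\<close>, it is 0 on \<open>V\<close>, and the
  critical sets are the proper subsets with slack 1. Everything rests on one identity
  (\<open>slack_modular\<close>): \<open>f\<close> is submodular, and the defect for \<open>X\<close>, \<open>Y\<close> is the number of
  edges between \<open>X - Y\<close> and \<open>Y - X\<close>. So critical sets that meet and do not cover \<open>V\<close> can
  be united and intersected, \<open>f X + f (V - X)\<close> edges leave \<open>X\<close>, and the excess of \<open>X\<close>,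
  which is the sum of \<open>deg v - 4\<close> over \<open>X\<close>, equals \<open>f (V - X) - f X\<close>.

  Suppose that no node is admissible. The reduction at a node \<open>v\<close> that adds the edge
  \<open>xy\<close> is blocked either by adjacency of \<open>x\<close> and \<open>y\<close> or by a critical set that contains
  \<open>x\<close> and \<open>y\<close> but neither \<open>v\<close> nor its third neighbour. Uncrossing these sets and using
  3-connectivity shows that the neighbours of a node are either pairwise adjacent (a
  clique node) or pairwise nonadjacent (an open node) (\<open>node_cases\<close>), and that a clique
  node has no node as a neighbour.

  Suppose that there is a proper critical set. Call the complement of a critical set
  cocritical. Among the cocritical sets with at least two vertices there is a minimal
  one, \<open>Y\<close>, without open nodes (\<open>min_cocritical_without_open\<close>): an open node comes with
  cocritical sets attached to its neighbours, and the smallest of those at a neighbour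
  that is not a node contains no two adjacent nodes, whereas a minimal cocritical set
  that contains an open node is a pair of adjacent nodes. Every node of \<open>Y\<close> then lies in
  a clique \<open>K\<^sub>4\<close> inside \<open>Y\<close>. Now discharge: a node has degree \<open>4 - 1\<close> and sends
  its deficit to a neighbour of degree at least 5. Two cliques that share an edge lie in
  a critical subset of \<open>Y\<close>; the maximal critical subsets are disjoint, and each is
  treated as a single vertex. The remaining cliques are edge-disjoint, so a vertex that
  receives much has large degree. Hence the excess of \<open>Y\<close> is nonnegative. But it equals
  \<open>1 - f Y\<close>, which is at most \<open>-2\<close> because at least four edges leave \<open>Y\<close>. This
  contradiction (\<open>no_cocritical\<close>) settles the essentially 4-edge-connected case.

  Without proper critical sets every node is a clique node. If the cliques of two nodes
  share an edge, the graph is \<open>G57\<close> or \<open>G59\<close>. Otherwise discharge over all of \<open>V\<close>, whose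
  excess is exactly 0: every estimate is tight. As at least five edges leave the clique
  of a node, tightness forces two nodes to share a neighbour of degree 6 while their
  other neighbours have degree 4. At most four edges leave the union of these two
  cliques, so with 3-connectivity the union is all of \<open>V\<close>, and the graph is \<open>G312\<close>
  (\<open>touching_pair_G312\<close>).
\<close>

section \<open>Slack and submodularity\<close>

locale simple_circuit =
  fixes G :: "'a ugraph"
  assumes circuit: "simple_circuit21 G"
begin

abbreviation "V \<equiv> vertices G"
abbreviation "E \<equiv> edges G"

definition nbrs :: "'a \<Rightarrow> 'a set" where
  "nbrs v = {u. {v, u} \<in> E}"

definition slack :: "'a set \<Rightarrow> int" where
  "slack X = 2 * int (card X) - int (induced_edge_count G X)"

definition excess :: "'a set \<Rightarrow> int" where
  "excess X = (\<Sum>v\<in>X. int (degree G v) - 4)"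

text \<open>For disjoint \<open>X\<close>, \<open>Y\<close> these are the edges from \<open>X\<close> to \<open>Y\<close>; in general they are the edges
  from \<open>X - Y\<close> to \<open>Y - X\<close>, which are the edges inside \<open>X \<union> Y\<close> that neither part induces.\<close>

definition cross :: "'a set \<Rightarrow> 'a set \<Rightarrow> 'a set set" where
  "cross X Y = {e \<in> E. e \<subseteq> X \<union> Y \<and> \<not> e \<subseteq> X \<and> \<not> e \<subseteq> Y}"

lemma finite_V [simp]: "finite V"
  using circuit by (simp add: simple_circuit21_def finite_simple_graph_def)

lemma finite_sub: "X \<subseteq> V \<Longrightarrow> finite X"
  using finite_subset finite_V by blast

lemma E_pairs: "e \<in> E \<Longrightarrow> e \<subseteq> V \<and> card e = 2"
  using circuit by (auto simp: simple_circuit21_def finite_simple_graph_def pairs_of_def)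

lemma E_sub: "e \<in> E \<Longrightarrow> x \<in> e \<Longrightarrow> x \<in> V"
  using E_pairs by blast

lemma finite_E [simp]: "finite E"
  by (rule finite_subset[of _ "Pow V"]) (auto intro: E_sub)

lemma edge_endpoints:
  assumes "e \<in> E"
  obtains a b where "e = {a, b}" "a \<noteq> b" "a \<in> V" "b \<in> V" "b \<in> nbrs a" "a \<in> nbrs b"
proof -
  have "card e = 2" "e \<subseteq> V" using E_pairs assms by auto
  then obtain a b where "e = {a, b}" "a \<noteq> b" by (auto simp: card_2_iff)
  then show thesis using that[of a b] assms \<open>e \<subseteq> V\<close>
    by (auto simp: nbrs_def insert_commute)
qed

lemma nbrs_sym: "u \<in> nbrs v \<longleftrightarrow> v \<in> nbrs u"
  by (simp add: nbrs_def insert_commute)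

lemma nbrs_V: "u \<in> nbrs v \<Longrightarrow> u \<in> V \<and> v \<in> V"
  using E_sub[of "{v, u}"] by (auto simp: nbrs_def)

lemma nbrs_sub: "nbrs v \<subseteq> V"
  using nbrs_V by blast

lemma finite_nbrs [simp]: "finite (nbrs v)"
  using nbrs_sub finite_sub by blast

lemma nbrs_irrefl [simp]: "v \<notin> nbrs v"
  using E_pairs[of "{v}"] by (auto simp: nbrs_def)

lemma card_edges_at: "v \<notin> X \<Longrightarrow> card {e \<in> E. v \<in> e \<and> e \<subseteq> insert v X} = card (nbrs v \<inter> X)"
proof -
  assume "v \<notin> X"
  have "bij_betw (\<lambda>u. {v, u}) (nbrs v \<inter> X) {e \<in> E. v \<in> e \<and> e \<subseteq> insert v X}"
    unfolding bij_betw_def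
  proof
    show "inj_on (\<lambda>u. {v, u}) (nbrs v \<inter> X)"
      by (auto simp: inj_on_def doubleton_eq_iff)
    show "(\<lambda>u. {v, u}) ` (nbrs v \<inter> X) = {e \<in> E. v \<in> e \<and> e \<subseteq> insert v X}"
    proof (intro equalityI subsetI)
      fix e assume "e \<in> {e \<in> E. v \<in> e \<and> e \<subseteq> insert v X}"
      then have e: "e \<in> E" "v \<in> e" "e \<subseteq> insert v X" by auto
      obtain a b where "e = {a, b}" "a \<noteq> b" "b \<in> nbrs a" "a \<in> nbrs b"
        using edge_endpoints[OF e(1)] by metis
      then show "e \<in> (\<lambda>u. {v, u}) ` (nbrs v \<inter> X)" using e(2,3) by auto
    qed (auto simp: nbrs_def)
  qed
  from bij_betw_same_card[OF this] show ?thesis by (rule sym)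
qed

lemma degree_nbrs: "degree G v = card (nbrs v)"
proof -
  have "e \<subseteq> insert v (V - {v})" if "e \<in> E" for e
    using E_sub[OF that] by blast
  then have "{e \<in> E. v \<in> e} = {e \<in> E. v \<in> e \<and> e \<subseteq> insert v (V - {v})}"
    by blast
  moreover have "nbrs v \<inter> (V - {v}) = nbrs v" using nbrs_sub[of v] by auto
  ultimately show ?thesis using card_edges_at[of v "V - {v}"] unfolding degree_def by simp
qed

lemma slack_empty [simp]: "slack {} = 0"
proof -
  have "{e \<in> E. e \<subseteq> {}} = {}" using E_pairs[of "{}"] by auto
  then show ?thesis by (simp add: slack_def induced_edge_count_def)
qed

lemma slack_V [simp]: "slack V = 0"
proof -
  have "{e \<in> E. e \<subseteq> V} = E" using E_sub by auto
  moreover have "card E = 2 * card V" using circuit unfolding simple_circuit21_def by blast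
  ultimately show ?thesis by (simp add: slack_def induced_edge_count_def)
qed

lemma slack_pos: "X \<noteq> {} \<Longrightarrow> X \<subseteq> V \<Longrightarrow> X \<noteq> V \<Longrightarrow> slack X \<ge> 1"
proof -
  assume "X \<noteq> {}" "X \<subseteq> V" "X \<noteq> V"
  then have "induced_edge_count G X + 1 \<le> 2 * card X"
    using circuit unfolding simple_circuit21_def by blast
  then show ?thesis by (simp add: slack_def)
qed

lemma slack_le0: "X \<noteq> {} \<Longrightarrow> X \<subseteq> V \<Longrightarrow> slack X \<le> 0 \<Longrightarrow> X = V"
  using slack_pos[of X] by linarith

lemma critical_iff_slack: "critical G X \<longleftrightarrow> X \<subset> V \<and> slack X = 1"
  by (auto simp: critical_def slack_def)

text \<open>Every edge inside \<open>X \<union> Y\<close> is induced by \<open>X\<close>, by \<open>Y\<close> or is a cross edge, and the edges that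
  both parts induce are those inside \<open>X \<inter> Y\<close>.\<close>

lemma slack_modular:
  assumes "X \<subseteq> V" "Y \<subseteq> V"
  shows "slack (X \<union> Y) + slack (X \<inter> Y) + int (card (cross X Y)) = slack X + slack Y"
proof -
  let ?i = "\<lambda>X. {e \<in> E. e \<subseteq> X}"
  have 1: "?i (X \<union> Y) = (?i X \<union> ?i Y) \<union> cross X Y" "(?i X \<union> ?i Y) \<inter> cross X Y = {}"
    "?i X \<inter> ?i Y = ?i (X \<inter> Y)"
    by (auto simp: cross_def)
  have "card (?i (X \<union> Y)) = card (?i X \<union> ?i Y) + card (cross X Y)"
    unfolding 1(1) using 1(2) by (subst card_Un_disjoint) (auto simp: cross_def)
  moreover have "card (?i X) + card (?i Y) = card (?i X \<union> ?i Y) + card (?i (X \<inter> Y))"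
    using card_Un_Int[of "?i X" "?i Y"] 1(3) by auto
  moreover have "card X + card Y = card (X \<union> Y) + card (X \<inter> Y)"
    using card_Un_Int[of X Y] assms finite_sub by auto
  ultimately show ?thesis by (simp add: slack_def induced_edge_count_def)
qed

lemma finite_cross [simp]: "finite (cross X Y)"
  by (simp add: cross_def)

lemma slack_submodular:
  "X \<subseteq> V \<Longrightarrow> Y \<subseteq> V \<Longrightarrow> slack (X \<union> Y) + slack (X \<inter> Y) \<le> slack X + slack Y"
  using slack_modular[of X Y] by linarith

lemma slack_insert:
  assumes "v \<notin> X" "X \<subseteq> V"
  shows "slack (insert v X) = slack X + 2 - int (card (nbrs v \<inter> X))"
proof -
  have "{e \<in> E. e \<subseteq> insert v X} = {e \<in> E. e \<subseteq> X} \<union> {e \<in> E. v \<in> e \<and> e \<subseteq> insert v X}"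
    by auto
  moreover have "{e \<in> E. e \<subseteq> X} \<inter> {e \<in> E. v \<in> e \<and> e \<subseteq> insert v X} = {}"
    using assms(1) by auto
  ultimately have "induced_edge_count G (insert v X)
      = induced_edge_count G X + card (nbrs v \<inter> X)"
    unfolding induced_edge_count_def card_edges_at[OF assms(1), symmetric]
    by (subst card_Un_disjoint[symmetric]) auto
  then show ?thesis using assms(1) finite_sub[OF assms(2)] by (simp add: slack_def)
qed

text \<open>Moving a vertex \<open>v\<close> from \<open>V - X\<close> to \<open>X\<close> changes \<open>slack (V - X) - slack X\<close> by \<open>deg v - 4\<close>,
  because each of its edges is counted once in exactly one of the two changes of slack.\<close>

lemma excess_slack:
  assumes "X \<subseteq> V"
  shows "excess X = slack (V - X) - slack X"
proof -
  have "finite X" using assms finite_sub by blast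
  then show ?thesis using assms
  proof (induction X)
    case empty
    then show ?case by (simp add: excess_def)
  next
    case (insert v X)
    let ?R = "V - insert v X"
    have R: "insert v ?R = V - X" using insert by auto
    have 1: "slack (V - X) = slack ?R + 2 - int (card (nbrs v \<inter> ?R))"
      unfolding R[symmetric] by (rule slack_insert) auto
    have 2: "slack (insert v X) = slack X + 2 - int (card (nbrs v \<inter> X))"
      using slack_insert[of v X] insert by simp
    have "(nbrs v \<inter> X) \<union> (nbrs v \<inter> ?R) = nbrs v"
      using nbrs_sub[of v] nbrs_irrefl[of v] by blast
    moreover have "card ((nbrs v \<inter> X) \<union> (nbrs v \<inter> ?R)) = card (nbrs v \<inter> X) + card (nbrs v \<inter> ?R)"
      by (rule card_Un_disjoint) auto
    ultimately have 3: "card (nbrs v) = card (nbrs v \<inter> X) + card (nbrs v \<inter> ?R)" by simp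
    have "excess (insert v X) = int (card (nbrs v)) - 4 + excess X"
      using insert by (simp add: excess_def degree_nbrs)
    then show ?case using 1 2 3 insert by simp
  qed
qed

lemma card_boundary:
  assumes "X \<subseteq> V"
  shows "int (card (cross X (V - X))) = slack X + slack (V - X)"
proof -
  have "X \<union> (V - X) = V" "X \<inter> (V - X) = {}" using assms by auto
  then show ?thesis using slack_modular[of X "V - X"] assms by simp
qed

lemma slack_remove:
  assumes "v \<in> V"
  shows "slack (V - {v}) = int (degree G v) - 2"
proof -
  have "slack {v} = 2" using slack_insert[of v "{}"] by simp
  then show ?thesis using excess_slack[of "{v}"] assms by (simp add: excess_def)
qed

lemma slack_singleton [simp]: "slack {v} = 2"
  using slack_insert[of v "{}"] by simp

text \<open>The right-hand side is twice the slack of a clique on as many vertices, the densest case.\<close>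

lemma slack_lower:
  assumes "X \<subseteq> V"
  shows "2 * slack X \<ge> int (card X) * (5 - int (card X))"
proof -
  have "finite X" using assms finite_sub by blast
  then show ?thesis using assms
  proof (induction X)
    case (insert v X)
    have "slack (insert v X) = slack X + 2 - int (card (nbrs v \<inter> X))"
      using slack_insert[of v X] insert by simp
    moreover have "card (nbrs v \<inter> X) \<le> card X" using insert by (intro card_mono) auto
    ultimately show ?case using insert by (simp add: algebra_simps)
  qed simp
qed

lemma slack_clique:
  assumes "X \<subseteq> V" "\<And>u v. u \<in> X \<Longrightarrow> v \<in> X \<Longrightarrow> u \<noteq> v \<Longrightarrow> v \<in> nbrs u"
  shows "2 * slack X = int (card X) * (5 - int (card X))"
proof -
  have "finite X" using assms finite_sub by blast
  then show ?thesis using assms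
  proof (induction X)
    case (insert v X)
    have "nbrs v \<inter> X = X" using insert.prems insert.hyps by auto
    then have "slack (insert v X) = slack X + 2 - int (card X)"
      using slack_insert[of v X] insert by simp
    then show ?case using insert by (simp add: algebra_simps)
  qed simp
qed

text \<open>The complete graphs on one to four vertices have slack 2, 3, 3, 2.\<close>

lemma critical_large:
  assumes "X \<subseteq> V" "X \<noteq> {}" "slack X \<le> 1"
  shows "card X \<ge> 5"
proof (rule ccontr)
  assume "\<not> card X \<ge> 5"
  moreover have "card X > 0" using assms finite_sub by (simp add: card_gt_0_iff)
  ultimately have "card X = 1 \<or> card X = 2 \<or> card X = 3 \<or> card X = 4" by linarith
  then show False using slack_lower[OF assms(1)] assms(3) by auto
qed

lemma degree_ge3:
  assumes "v \<in> V"
  shows "degree G v \<ge> 3"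
proof -
  have "V \<noteq> {v}" using slack_singleton[of v] slack_V by (metis zero_neq_numeral)
  then show ?thesis using slack_pos[of "V - {v}"] slack_remove[OF assms] assms by fastforce
qed

text \<open>The uncrossing step used throughout: both the union and the intersection have slack at least
  1, so submodularity holds with equality.\<close>

lemma critical_Un:
  assumes "X \<subseteq> V" "Y \<subseteq> V" "slack X = 1" "slack Y = 1" "X \<inter> Y \<noteq> {}" "X \<union> Y \<noteq> V"
  shows "slack (X \<union> Y) = 1" "slack (X \<inter> Y) = 1" "cross X Y = {}"
proof -
  have "X \<inter> Y \<noteq> V" using assms by auto
  then have "slack (X \<union> Y) \<ge> 1" "slack (X \<inter> Y) \<ge> 1"
    using assms by (auto intro!: slack_pos)
  then have "slack (X \<union> Y) = 1 \<and> slack (X \<inter> Y) = 1 \<and> card (cross X Y) = 0"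
    using slack_modular[of X Y] assms by linarith
  then show "slack (X \<union> Y) = 1" "slack (X \<inter> Y) = 1" "cross X Y = {}"
    by auto
qed

end

section \<open>Consequences of connectivity\<close>

locale three_connected_circuit = simple_circuit +
  assumes three_connected: "k_connected 3 G"
begin

text \<open>The form in which 3-connectivity is used: \<open>N\<close> separates \<open>S\<close> from the remaining vertices, so there
  are none.\<close>

lemma no_small_separator:
  assumes "S \<noteq> {}" "S \<subseteq> V" "N \<subseteq> V" "card N \<le> 2"
    and closed: "\<And>u. u \<in> S \<Longrightarrow> nbrs u \<subseteq> S \<union> N"
    and disj: "S \<inter> N = {}"
  shows "V = S \<union> N"
proof (rule ccontr)
  assume "V \<noteq> S \<union> N"
  then obtain t where t: "t \<in> V" "t \<notin> S" "t \<notin> N" using assms by blast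
  obtain s where s: "s \<in> S" using assms by blast
  let ?H = "delete_vertices G N"
  have "connected_graph ?H" using three_connected assms by (auto simp: k_connected_def)
  then have "(s, t) \<in> (adj_rel ?H)\<^sup>*"
    using s t assms disj by (auto simp: connected_graph_def delete_vertices_def)
  then have "t \<in> S"
  proof (induction rule: rtrancl_induct)
    case (step y z)
    then have "z \<in> nbrs y" "z \<notin> N"
      by (auto simp: adj_rel_def delete_vertices_def nbrs_def)
    then show ?case using closed[of y] step by auto
  qed (rule s)
  then show False using t by simp
qed

text \<open>The left-hand side is the number of edges that leave \<open>S\<close>. If it were 2, then \<open>S\<close> would be
  critical, hence have at least five vertices, and the at most two ends in \<open>S\<close> of the leaving
  edges would separate the rest of \<open>S\<close> from \<open>V - S\<close>.\<close>

lemma slack_pair_cut: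
  assumes "S \<subseteq> V" "S \<noteq> {}" "S \<noteq> V"
  shows "slack S + slack (V - S) \<ge> 3"
proof (rule ccontr)
  assume "\<not> slack S + slack (V - S) \<ge> 3"
  moreover have "slack S \<ge> 1" "slack (V - S) \<ge> 1"
    using assms by (auto intro!: slack_pos)
  ultimately have eq: "slack S = 1" "slack (V - S) = 1" by auto
  let ?F = "cross S (V - S)"
  have cF: "card ?F = 2" using card_boundary[OF assms(1)] eq by simp
  define N where "N = (\<Union>e\<in>?F. e \<inter> S)"
  have "card (e \<inter> S) \<le> 1" if e: "e \<in> ?F" for e
  proof -
    have "e \<in> E" using e by (simp add: cross_def)
    then obtain a b where "e = {a, b}" "a \<noteq> b" using edge_endpoints by metis
    then show ?thesis using e by (auto simp: cross_def Int_insert_left)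
  qed
  then have "card N \<le> (\<Sum>e\<in>?F. 1)"
    unfolding N_def by (intro order_trans[OF card_UN_le sum_mono]) auto
  then have cN: "card N \<le> 2" using cF by simp
  have NS: "N \<subseteq> S" by (auto simp: N_def)
  have "card S \<ge> 5" using critical_large assms eq by simp
  moreover have "finite N" using NS assms finite_sub finite_subset by blast
  ultimately have "S - N \<noteq> {}" using cN card_mono[of N S] by auto
  moreover have "nbrs u \<subseteq> (S - N) \<union> N" if u: "u \<in> S - N" for u
  proof
    fix w assume w: "w \<in> nbrs u"
    show "w \<in> (S - N) \<union> N"
    proof (rule ccontr)
      assume "w \<notin> (S - N) \<union> N"
      then have "{u, w} \<in> ?F" using w u nbrs_V[OF w]
        by (auto simp: cross_def nbrs_def)
      then show False using u by (auto simp: N_def)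
    qed
  qed
  ultimately have "V = (S - N) \<union> N"
    using no_small_separator[of "S - N" N] assms NS cN by auto
  then show False using assms NS by auto
qed

text \<open>The \<open>k\<close> edges that leave \<open>S\<close> form a cutset. If it were trivial, with isolated vertex \<open>v\<close> on the
  side \<open>T\<close>, then all edges of \<open>v\<close> leave \<open>T\<close>, so \<open>slack (T - {v}) = slack T - 2\<close> and
  \<open>slack (insert v (V - T)) = slack (V - T) + 2 - deg v\<close>. Both are at least 1, which
  gives at least five leaving edges.\<close>

lemma essential_cut:
  assumes ess: "essentially_edge_connected (k + 1) G" and k: "k \<le> 4"
    and S: "S \<subseteq> V" "card S \<ge> 2" "card (V - S) \<ge> 2"
  shows "slack S + slack (V - S) \<noteq> int k"
proof
  assume eq: "slack S + slack (V - S) = int k"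
  let ?F = "cross S (V - S)"
  have cF: "card ?F = k" using card_boundary[OF S(1)] eq by simp
  have FE: "?F \<subseteq> E" by (auto simp: cross_def)
  let ?H = "delete_edges G ?F"
  obtain s t where st: "s \<in> S" "t \<in> V - S" 
    using S by (metis card.empty ex_in_conv not_numeral_le_zero)
  have "(s, t) \<notin> (adj_rel ?H)\<^sup>*"
  proof
    assume "(s, t) \<in> (adj_rel ?H)\<^sup>*"
    then have "t \<in> S"
    proof (induction rule: rtrancl_induct)
      case (step y z)
      then have "{y, z} \<in> E" "{y, z} \<notin> ?F" by (auto simp: adj_rel_def delete_edges_def)
      then show ?case using step(3) E_pairs[of "{y, z}"] by (auto simp: cross_def)
    qed (use st in auto)
    then show False using st by simp
  qed
  then have "edge_cutset k G ?F"
    using cF FE st S(1) unfolding edge_cutset_def connected_graph_def delete_edges_def by auto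
  then have "trivial_cutset G ?F" using ess unfolding essentially_edge_connected_def by blast
  then obtain v where v: "v \<in> V" "component_of ?H v = {v}" unfolding trivial_cutset_def by blast
  have iso: "{v, u} \<in> ?F" if u: "u \<in> nbrs v" for u
  proof (rule ccontr)
    assume "{v, u} \<notin> ?F"
    then have "(v, u) \<in> adj_rel ?H" using u by (auto simp: adj_rel_def delete_edges_def nbrs_def)
    then have "u \<in> component_of ?H v"
      using nbrs_V[OF u] by (auto simp: component_of_def delete_edges_def)
    then show False using v u by auto
  qed
  have key: False if T: "T \<subseteq> V" "card T \<ge> 2" "card (V - T) \<ge> 2" "v \<in> T"
    "slack T + slack (V - T) \<le> 4" "nbrs v \<inter> T = {}" for T
  proof -
    have ne: "T - {v} \<noteq> {}"
    proof
      assume "T - {v} = {}"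
      then have "T \<subseteq> {v}" by auto
      then show False using card_mono[of "{v}" T] T(2) by simp
    qed
    then have 1: "slack (T - {v}) \<ge> 1" using T by (intro slack_pos) auto
    have 2: "slack T = slack (T - {v}) + 2 - int (card (nbrs v \<inter> (T - {v})))"
      using slack_insert[of v "T - {v}"] T by (auto simp: insert_absorb)
    have "nbrs v \<inter> (T - {v}) = {}" "nbrs v \<inter> (V - T) = nbrs v" using T nbrs_sub[of v] by auto
    moreover have "slack (insert v (V - T)) = slack (V - T) + 2 - int (card (nbrs v \<inter> (V - T)))"
      using T by (intro slack_insert) auto
    moreover have "slack (insert v (V - T)) \<ge> 1"
      using ne T by (intro slack_pos) auto
    moreover have "card (nbrs v) \<ge> 3" using degree_ge3[OF v(1)] degree_nbrs by simp
    ultimately show False using 1 2 T(5) by simp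
  qed
  show False
  proof (cases "v \<in> S")
    case True
    then have "nbrs v \<inter> S = {}" using iso by (force simp: cross_def)
    then show False using key[of S] S True eq k by simp
  next
    case False
    then have "nbrs v \<inter> (V - S) = {}" using iso v(1) by (force simp: cross_def)
    moreover have "V - (V - S) = S" using S(1) by auto
    ultimately show False using key[of "V - S"] S v(1) False eq k by simp
  qed
qed

end

section \<open>Recognising three exceptional graphs\<close>

lemma doubleton_pairs_of: "{p, q} \<in> pairs_of A \<longleftrightarrow> p \<noteq> q \<and> p \<in> A \<and> q \<in> A"
  by (auto simp: pairs_of_def card_insert_if)

lemma P_atLeastAtMost6: "P ` {1..6} = {P 1, P 2, P 3, P 4, P 5, P 6}"
proof -
  have "{1..6::nat} = {1, 2, 3, 4, 5, 6}" by auto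
  then show ?thesis by simp
qed

context simple_circuit begin

text \<open>A surjection between finite sets of equal size is injective.\<close>

lemma graph_isoI:
  assumes "f ` V = vertices H" "card (vertices H) = card V"
    and "\<forall>x\<in>V. \<forall>y\<in>V. y \<in> nbrs x \<longleftrightarrow> {f x, f y} \<in> edges H"
  shows "graph_iso G H"
proof -
  have "inj_on f V" using assms(1,2) by (intro eq_card_imp_inj_on) auto
  then show ?thesis using assms by (auto simp: graph_iso_def nbrs_def bij_betw_def)
qed

lemma iso_G57:
  assumes V: "V = {a, b, c, x, y, z}" and d: "distinct [a, b, c, x, y, z]"
    and N: "nbrs a = {x, y, z}" "nbrs b = {x, y, z}" "nbrs c = {x, y, z}"
      "nbrs x = {a, b, c, y, z}" "nbrs y = {a, b, c, x, z}" "nbrs z = {a, b, c, x, y}"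
  shows "graph_iso G G57"
proof -
  define f where "f = (\<lambda>u. if u = a then P 1 else if u = b then P 2 else if u = c then P 3
    else if u = x then P 4 else if u = y then P 5 else P 6)"
  have f: "f a = P 1" "f b = P 2" "f c = P 3" "f x = P 4" "f y = P 5" "f z = P 6"
    using d by (auto simp: f_def)
  have H: "vertices G57 = {P 1, P 2, P 3, P 4, P 5, P 6}"
    by (simp only: G57_def delete_edges_def complete_graph_def fst_conv P_atLeastAtMost6)
  have E: "{p, q} \<in> edges G57 \<longleftrightarrow> p \<noteq> q \<and> p \<in> {P 1, P 2, P 3, P 4, P 5, P 6} \<and>
      q \<in> {P 1, P 2, P 3, P 4, P 5, P 6} \<and> {p, q} \<notin> {{P 1, P 2}, {P 2, P 3}, {P 1, P 3}}" for p q
    unfolding G57_def delete_edges_def complete_graph_def snd_conv Diff_iff doubleton_pairs_of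
      P_atLeastAtMost6 by (rule refl | simp only: conj_assoc)+
  show ?thesis
  proof (rule graph_isoI)
    show "f ` V = vertices G57" unfolding V H by (simp add: f)
    show "card (vertices G57) = card V" unfolding V H using d by simp
    show "\<forall>u\<in>V. \<forall>w\<in>V. w \<in> nbrs u \<longleftrightarrow> {f u, f w} \<in> edges G57"
      using d unfolding V by (simp add: E f N doubleton_eq_iff) auto
  qed
qed

lemma iso_G59:
  assumes V: "V = {a, b, c, d, x, y}" and d: "distinct [a, b, c, d, x, y]"
    and N: "nbrs a = {c, d, x, y}" "nbrs b = {d, x, y}" "nbrs c = {a, x, y}"
      "nbrs d = {a, b, x, y}" "nbrs x = {a, b, c, d, y}" "nbrs y = {a, b, c, d, x}"
  shows "graph_iso G G59"
proof -
  define f where "f = (\<lambda>u. if u = a then P 1 else if u = b then P 2 else if u = c then P 3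
    else if u = d then P 4 else if u = x then P 5 else P 6)"
  have f: "f a = P 1" "f b = P 2" "f c = P 3" "f d = P 4" "f x = P 5" "f y = P 6"
    using d by (auto simp: f_def)
  have H: "vertices G59 = {P 1, P 2, P 3, P 4, P 5, P 6}"
    by (simp only: G59_def delete_edges_def complete_graph_def fst_conv P_atLeastAtMost6)
  have E: "{p, q} \<in> edges G59 \<longleftrightarrow> p \<noteq> q \<and> p \<in> {P 1, P 2, P 3, P 4, P 5, P 6} \<and>
      q \<in> {P 1, P 2, P 3, P 4, P 5, P 6} \<and> {p, q} \<notin> {{P 1, P 2}, {P 2, P 3}, {P 3, P 4}}" for p q
    unfolding G59_def delete_edges_def complete_graph_def snd_conv Diff_iff doubleton_pairs_of
      P_atLeastAtMost6 by (rule refl | simp only: conj_assoc)+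
  show ?thesis
  proof (rule graph_isoI)
    show "f ` V = vertices G59" unfolding V H by (simp add: f)
    show "card (vertices G59) = card V" unfolding V H using d by simp
    show "\<forall>u\<in>V. \<forall>w\<in>V. w \<in> nbrs u \<longleftrightarrow> {f u, f w} \<in> edges G59"
      using d unfolding V by (simp add: E f N doubleton_eq_iff) auto
  qed
qed

lemma iso_G312:
  assumes V: "V = {x, v, y, z, w, y', z'}" and d: "distinct [x, v, y, z, w, y', z']"
    and N: "nbrs x = {v, y, z, w, y', z'}" "nbrs v = {x, y, z}" "nbrs w = {x, y', z'}"
      "nbrs y = {v, x, z, y'}" "nbrs z = {v, x, y, z'}"
      "nbrs y' = {w, x, z', y}" "nbrs z' = {w, x, y', z}"
  shows "graph_iso G G312"
proof -
  define f where "f = (\<lambda>u. if u = x then Vc else if u = y then P 1 else if u = z then P 2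
    else if u = v then P 3 else if u = y' then Q 1 else if u = z' then Q 2 else Q 3)"
  have f: "f x = Vc" "f y = P 1" "f z = P 2" "f v = P 3" "f y' = Q 1" "f z' = Q 2" "f w = Q 3"
    using d by (auto simp: f_def)
  have H: "vertices G312 = {Vc, P 1, P 2, P 3, Q 1, Q 2, Q 3}"
    by (auto simp: G312_def add_edges_def graph_union_def complete_graph_def)
  have E: "{p, q} \<in> edges G312 \<longleftrightarrow>
      p \<noteq> q \<and> p \<in> {Vc, P 1, P 2, P 3} \<and> q \<in> {Vc, P 1, P 2, P 3} \<or>
      p \<noteq> q \<and> p \<in> {Vc, Q 1, Q 2, Q 3} \<and> q \<in> {Vc, Q 1, Q 2, Q 3} \<or>
      {p, q} \<in> {{P 1, Q 1}, {P 2, Q 2}}" for p q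
    unfolding G312_def add_edges_def graph_union_def complete_graph_def snd_conv Un_iff
      doubleton_pairs_of by (rule refl | simp only: disj_assoc)+
  show ?thesis
  proof (rule graph_isoI)
    show "f ` V = vertices G312" unfolding V H by (simp add: f) blast
    show "card (vertices G312) = card V" unfolding V H using d by simp
    show "\<forall>u\<in>V. \<forall>w\<in>V. w \<in> nbrs u \<longleftrightarrow> {f u, f w} \<in> edges G312"
      using d unfolding V by (simp add: E f N doubleton_eq_iff) auto
  qed
qed

end

section \<open>Nodes without an admissible reduction\<close>

lemma card_le1_eq_singleton:
  assumes "finite S" "card S \<le> 1" "x \<in> S"
  shows "S = {x}"
  using card_seteq[of S "{x}"] assms by simp

context simple_circuit begin

lemma node_iff: "node G v \<longleftrightarrow> v \<in> V \<and> card (nbrs v) = 3"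
  by (simp add: node_def degree_nbrs)

text \<open>Adding \<open>v\<close> together with its three edges lowers the slack of \<open>A\<close> to 0.\<close>

lemma slack_add_full:
  assumes "node G v" "A \<subseteq> V" "v \<notin> A" "slack A = 1" "nbrs v \<subseteq> A"
  shows "A = V - {v}"
proof -
  have "nbrs v \<inter> A = nbrs v" using assms by auto
  then have "slack (insert v A) = 0" using slack_insert[of v A] assms by (simp add: node_iff)
  then have "insert v A = V" using slack_le0[of "insert v A"] assms by (auto simp: node_iff)
  then show ?thesis using assms by auto
qed

lemma slack_remove_node: "node G v \<Longrightarrow> slack (V - {v}) = 1"
  using slack_remove[of v] by (simp add: node_def)

lemma order_ge6: "node G v \<Longrightarrow> card V \<ge> 6"
proof -
  assume v: "node G v"
  have "V - {v} \<noteq> {}" using slack_remove_node[OF v] slack_empty by (metis zero_neq_one)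
  then have "card (V - {v}) \<ge> 5" using critical_large slack_remove_node[OF v] by simp
  then show ?thesis using v by (simp add: node_iff)
qed

text \<open>Deleting a node costs one vertex and three edges, and the new edge restores the edge count. The
  new edge raises the number of induced edges only for sets that contain both its ends, and such
  a set has room for it unless it is critical.\<close>

lemma one_reduction_circuit:
  assumes v: "node G v" and xy: "x \<in> nbrs v" "y \<in> nbrs v" "x \<noteq> y" "y \<notin> nbrs x"
    and crit: "\<And>X. X \<subset> V - {v} \<Longrightarrow> x \<in> X \<Longrightarrow> y \<in> X \<Longrightarrow> slack X \<noteq> 1"
  shows "simple_circuit21 (one_reduction G v x y)"
proof -
  let ?W = "V - {v}"
  let ?F = "{e \<in> E. e \<subseteq> ?W}"
  have "{e \<in> E. e \<inter> {v} = {}} = ?F" using E_sub by blast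
  then have H: "one_reduction G v x y = (?W, insert {x, y} ?F)"
    by (simp add: one_reduction_def delete_vertices_def)
  have new: "{x, y} \<notin> E" using xy by (simp add: nbrs_def)
  have W: "x \<in> ?W" "y \<in> ?W" using xy nbrs_V[of x v] nbrs_V[of y v] by auto
  have "2 * int (card ?W) - int (card ?F) = 1"
    using slack_remove_node[OF v] by (simp add: slack_def induced_edge_count_def)
  moreover have "card (insert {x, y} ?F) = card ?F + 1" using new by simp
  ultimately have count: "card (insert {x, y} ?F) = 2 * card ?W" by linarith
  have "?F \<subseteq> pairs_of ?W" using E_pairs by (auto simp: pairs_of_def)
  then have simp: "insert {x, y} ?F \<subseteq> pairs_of ?W" using W xy by (auto simp: pairs_of_def)
  have "card {e \<in> insert {x, y} ?F. e \<subseteq> X} + 1 \<le> 2 * card X"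
    if X: "X \<noteq> {}" "X \<subset> ?W" for X
  proof -
    have XV: "X \<subseteq> V" "X \<noteq> V" using X by auto
    let ?I = "{e \<in> E. e \<subseteq> X}"
    have pos: "slack X \<ge> 1" using slack_pos X XV by simp
    show ?thesis
    proof (cases "x \<in> X \<and> y \<in> X")
      case True
      then have "slack X \<ge> 2" using crit[of X] X pos by force
      then have I: "card ?I + 2 \<le> 2 * card X" by (simp add: slack_def induced_edge_count_def)
      have "{e \<in> insert {x, y} ?F. e \<subseteq> X} \<subseteq> insert {x, y} ?I" by auto
      then have "card {e \<in> insert {x, y} ?F. e \<subseteq> X} \<le> card (insert {x, y} ?I)"
        by (intro card_mono) auto
      also have "\<dots> \<le> card ?I + 1" using card_insert_le_m1[of "card ?I + 1" ?I] by simp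
      finally show ?thesis using I by simp
    next
      case False
      then have "{e \<in> insert {x, y} ?F. e \<subseteq> X} \<subseteq> ?I" by auto
      then have "card {e \<in> insert {x, y} ?F. e \<subseteq> X} \<le> card ?I" by (intro card_mono) auto
      then show ?thesis using pos by (simp add: slack_def induced_edge_count_def)
    qed
  qed
  then show ?thesis
    unfolding H simple_circuit21_def finite_simple_graph_def induced_edge_count_def fst_conv snd_conv
    using count simp finite_V by blast
qed

end

locale circuit_without_admissible = three_connected_circuit +
  assumes no_admissible: "\<not> (\<exists>v. admissible G v)"
begin

lemma blocking_set:
  assumes v: "node G v" and xy: "x \<in> nbrs v" "y \<in> nbrs v" "x \<noteq> y" "y \<notin> nbrs x"
  obtains A where "A \<subseteq> V" "v \<notin> A" "x \<in> A" "y \<in> A" "slack A = 1" "\<not> nbrs v \<subseteq> A"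
proof -
  have "\<not> simple_circuit21 (one_reduction G v x y)"
    using no_admissible v xy unfolding admissible_def nbrs_def by blast
  then obtain X where X: "X \<subset> V - {v}" "x \<in> X" "y \<in> X" "slack X = 1"
    using one_reduction_circuit[OF assms] by blast
  moreover have "\<not> nbrs v \<subseteq> X" using slack_add_full[OF v, of X] X by blast
  ultimately show thesis using that[of X] by blast
qed

definition clique_node :: "'a \<Rightarrow> bool" where
  "clique_node v \<longleftrightarrow> node G v \<and> (\<forall>x\<in>nbrs v. \<forall>y\<in>nbrs v. x \<noteq> y \<longrightarrow> y \<in> nbrs x)"

definition open_node :: "'a \<Rightarrow> bool" where
  "open_node v \<longleftrightarrow> node G v \<and> (\<forall>x\<in>nbrs v. \<forall>y\<in>nbrs v. y \<notin> nbrs x)"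

lemma nbrs3:
  assumes "node G v"
  obtains x y z where "nbrs v = {x, y, z}" "x \<noteq> y" "x \<noteq> z" "y \<noteq> z"
  using assms by (auto simp: node_iff card_3_iff)

lemma nbrs3_at:
  assumes "node G v" "x \<in> nbrs v"
  obtains y z where "nbrs v = {x, y, z}" "x \<noteq> y" "x \<noteq> z" "y \<noteq> z"
proof -
  obtain a b c where abc: "nbrs v = {a, b, c}" "a \<noteq> b" "a \<noteq> c" "b \<noteq> c"
    using nbrs3[OF assms(1)] by metis
  consider "x = a" | "x = b" | "x = c" using abc assms by auto
  then show thesis
  proof cases
    case 1 then show thesis using that[of b c] abc by auto
  next
    case 2 then show thesis using that[of a c] abc by auto
  next
    case 3 then show thesis using that[of a b] abc by auto
  qed
qed

lemma nbrs3_at2: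
  assumes "node G v" "x \<in> nbrs v" "y \<in> nbrs v" "x \<noteq> y"
  obtains z where "nbrs v = {x, y, z}" "x \<noteq> z" "y \<noteq> z"
proof -
  obtain a b where "nbrs v = {x, a, b}" "x \<noteq> a" "x \<noteq> b" "a \<noteq> b"
    using nbrs3_at[OF assms(1,2)] by metis
  then show thesis using that[of a] that[of b] assms by auto
qed

text \<open>Let \<open>A\<close> block the pair \<open>x\<close>, \<open>y\<close>. If \<open>z\<close> is not adjacent to \<open>y\<close>, then a set \<open>B\<close> that blocks \<open>y\<close>, \<open>z\<close>
  can be uncrossed with \<open>A\<close>, but \<open>xz\<close> is an edge between \<open>A - B\<close> and \<open>B - A\<close>. If \<open>z\<close> is
  adjacent to \<open>y\<close>, then adding \<open>z\<close> and \<open>v\<close> to \<open>A\<close> exhausts the slack, so \<open>z\<close> has no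
  further neighbours and \<open>{x, y}\<close> separates \<open>{v, z}\<close> from the rest.\<close>

lemma no_mixed_nbrs:
  assumes v: "node G v" and N: "nbrs v = {x, y, z}" "x \<noteq> y" "x \<noteq> z" "y \<noteq> z"
    and xy: "y \<notin> nbrs x" and xz: "z \<in> nbrs x"
  shows False
proof -
  have vV: "v \<in> V" using v by (simp add: node_iff)
  obtain A where A: "A \<subseteq> V" "v \<notin> A" "x \<in> A" "y \<in> A" "slack A = 1" "z \<notin> A"
    using blocking_set[OF v, of x y] N xy by auto
  show False
  proof (cases "z \<in> nbrs y")
    case False
    obtain B where B: "B \<subseteq> V" "v \<notin> B" "y \<in> B" "z \<in> B" "slack B = 1" "x \<notin> B"
      using blocking_set[OF v, of y z] N False by auto
    have "cross A B = {}" using critical_Un[of A B] A B vV by blast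
    moreover have "{x, z} \<in> cross A B" using A B xz by (auto simp: cross_def nbrs_def)
    ultimately show False by simp
  next
    case True
    have zV: "z \<in> V" using N nbrs_V[of z v] by simp
    have "slack (insert z A) = 3 - int (card (nbrs z \<inter> A))"
      using slack_insert[of z A] A by simp
    moreover have "{x, y} \<subseteq> nbrs z \<inter> A" using A True xz nbrs_sym by auto
    then have ge: "card (nbrs z \<inter> A) \<ge> 2"
      using card_mono[of "nbrs z \<inter> A" "{x, y}"] N by simp
    moreover have "insert z A \<subseteq> V" "v \<notin> insert z A"
      using A zV N(1) nbrs_irrefl[of v] by auto
    then have "slack (insert z A) \<ge> 1" using vV by (intro slack_pos) auto
    ultimately have two: "card (nbrs z \<inter> A) = 2" "slack (insert z A) = 1" by auto
    have zA: "nbrs z \<inter> A = {x, y}"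
      using card_seteq[of "nbrs z \<inter> A" "{x, y}"] \<open>{x, y} \<subseteq> nbrs z \<inter> A\<close> two(1) N by simp
    have V: "insert z A = V - {v}"
      using slack_add_full[OF v, of "insert z A"] two \<open>insert z A \<subseteq> V\<close> \<open>v \<notin> insert z A\<close> A N(1)
      by auto
    have zN: "nbrs z \<subseteq> {v, x, y}"
    proof
      fix u assume "u \<in> nbrs z"
      then have "u \<in> V" "u \<noteq> z" using nbrs_V by auto
      then show "u \<in> {v, x, y}" using V zA \<open>u \<in> nbrs z\<close> by blast
    qed
    have "V = {v, z} \<union> {x, y}"
    proof (rule no_small_separator)
      show "{v, z} \<inter> {x, y} = {}" using A N(3,4) by auto
      show "{x, y} \<subseteq> V" "{v, z} \<subseteq> V" using A vV zV by auto
      show "nbrs u \<subseteq> {v, z} \<union> {x, y}" if "u \<in> {v, z}" for u using that N(1) zN by auto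
    qed (auto simp: card_insert_if)
    then have "card V \<le> 4" using card_insert_le_m1[of 4] by (simp add: card_insert_if)
    then show False using order_ge6[OF v] by simp
  qed
qed

lemma node_cases:
  assumes "node G v"
  shows "clique_node v \<or> open_node v"
proof -
  obtain x y z where N: "nbrs v = {x, y, z}" "x \<noteq> y" "x \<noteq> z" "y \<noteq> z"
    using nbrs3[OF assms] by metis
  note mix = no_mixed_nbrs[OF assms]
  have perm: "nbrs v = {x, z, y}" "nbrs v = {y, x, z}" "nbrs v = {y, z, x}" "nbrs v = {z, x, y}"
    "nbrs v = {z, y, x}" using N by auto
  have 1: "y \<notin> nbrs x \<Longrightarrow> z \<notin> nbrs x" using mix[OF N] by blast
  have 2: "y \<notin> nbrs x \<Longrightarrow> z \<notin> nbrs y"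
    using mix[OF perm(2)] N nbrs_sym by blast
  have 3: "z \<notin> nbrs x \<Longrightarrow> y \<notin> nbrs x" using mix[OF perm(1)] N by blast
  have 4: "z \<notin> nbrs y \<Longrightarrow> y \<notin> nbrs x" using mix[OF perm(3)] N nbrs_sym by blast
  show ?thesis
  proof (cases "y \<in> nbrs x")
    case True
    then have "z \<in> nbrs x" "z \<in> nbrs y" using 3 4 by auto
    then have "clique_node v" using assms N True by (auto simp: clique_node_def nbrs_sym)
    then show ?thesis ..
  next
    case False
    then have "z \<notin> nbrs x" "z \<notin> nbrs y" using 1 2 by auto
    then have "open_node v" using assms N False by (auto simp: open_node_def nbrs_sym)
    then show ?thesis ..
  qed
qed

text \<open>Two adjacent nodes \<open>v\<close>, \<open>x\<close>, with \<open>v\<close> in a clique with its neighbours, have the same two other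
  neighbours, which would separate them from the rest.\<close>

lemma clique_node_nbrs:
  assumes "clique_node v" "x \<in> nbrs v"
  shows "\<not> node G x"
proof
  assume x: "node G x"
  have v: "node G v" using assms by (simp add: clique_node_def)
  obtain y z where N: "nbrs v = {x, y, z}" "x \<noteq> y" "x \<noteq> z" "y \<noteq> z"
    using nbrs3_at[OF v assms(2)] by metis
  have vn: "v \<notin> {x, y, z}" using N nbrs_irrefl[of v] by auto
  have "{v, y, z} \<subseteq> nbrs x"
    using assms N nbrs_sym unfolding clique_node_def by auto
  moreover have "card {v, y, z} = 3" using N vn by auto
  ultimately have Nx: "nbrs x = {v, y, z}"
    using x card_seteq[of "nbrs x" "{v, y, z}"] by (simp add: node_iff)
  have "V = {v, x} \<union> {y, z}"
  proof (rule no_small_separator)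
    show "{v, x} \<inter> {y, z} = {}" using N vn by auto
    show "{y, z} \<subseteq> V" "{v, x} \<subseteq> V" using v N(1) nbrs_sub[of v] by (auto simp: node_iff)
    show "nbrs u \<subseteq> {v, x} \<union> {y, z}" if "u \<in> {v, x}" for u using that N(1) Nx by auto
  qed (auto simp: card_insert_if)
  then have "card V \<le> 4" by (simp add: card_insert_if)
  then show False using order_ge6[OF v] by simp
qed

lemma adjacent_nodes_open:
  assumes "node G v" "node G u" "u \<in> nbrs v"
  shows "open_node v"
  using node_cases[OF assms(1)] clique_node_nbrs[of v u] assms by blast

section \<open>Arms and cocritical sets\<close>

text \<open>The set \<open>V - insert v L\<close> is a critical set that blocks the pair of neighbours of \<open>v\<close> other
  than \<open>z\<close>; it is convenient to work with the complementary part \<open>L\<close>, which contains \<open>z\<close>.\<close>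

definition arm :: "'a \<Rightarrow> 'a \<Rightarrow> 'a set \<Rightarrow> bool" where
  "arm v z L \<longleftrightarrow> L \<subseteq> V \<and> v \<notin> L \<and> L \<inter> nbrs v = {z} \<and> slack (V - insert v L) = 1"

lemma arm_exists:
  assumes "open_node v" "z \<in> nbrs v"
  obtains L where "arm v z L"
proof -
  have v: "node G v" using assms by (simp add: open_node_def)
  obtain x y where N: "nbrs v = {z, x, y}" "z \<noteq> x" "z \<noteq> y" "x \<noteq> y"
    using nbrs3_at[OF v assms(2)] by metis
  obtain A where A: "A \<subseteq> V" "v \<notin> A" "x \<in> A" "y \<in> A" "slack A = 1" "z \<notin> A"
    using blocking_set[OF v, of x y] N assms by (auto simp: open_node_def)
  have "V - insert v (V - insert v A) = A" using A v by (auto simp: node_iff)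
  moreover have "(V - insert v A) \<inter> nbrs v = {z}"
    using A N nbrs_V[of z v] nbrs_irrefl[of v] by auto
  ultimately have "arm v z (V - insert v A)" using A by (auto simp: arm_def)
  then show thesis by (rule that)
qed

lemma arm_rest_nbrs: "arm v z L \<Longrightarrow> nbrs v - {z} \<subseteq> V - insert v L"
  using nbrs_sub[of v] nbrs_irrefl[of v] by (auto simp: arm_def)

text \<open>The two blocking sets share the third neighbour of \<open>v\<close>, so their union is critical; it contains
  all neighbours of \<open>v\<close> and therefore is \<open>V - {v}\<close>.\<close>

lemma arms_disjoint:
  assumes v: "node G v" and L: "arm v z L" "arm v z' L'" "z \<noteq> z'"
  shows "L \<inter> L' = {}"
proof -
  have vV: "v \<in> V" using v by (simp add: node_iff)
  let ?A = "V - insert v L" and ?B = "V - insert v L'"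
  have z: "z \<in> nbrs v" "z' \<in> nbrs v" using L by (auto simp: arm_def)
  obtain w where N: "nbrs v = {z, z', w}" "z \<noteq> w" "z' \<noteq> w"
    using nbrs3_at2[OF v z L(3)] by metis
  have sub: "nbrs v - {z} \<subseteq> ?A" "nbrs v - {z'} \<subseteq> ?B"
    using arm_rest_nbrs L by auto
  have "w \<in> ?A \<inter> ?B" using sub N by auto
  then have "slack (?A \<union> ?B) = 1"
    using critical_Un(1)[of ?A ?B] L vV by (auto simp: arm_def)
  moreover have "nbrs v \<subseteq> ?A \<union> ?B" using sub L(3) by auto
  ultimately have "?A \<union> ?B = V - {v}" using slack_add_full[OF v, of "?A \<union> ?B"] by auto
  then show ?thesis using L by (auto simp: arm_def)
qed

definition cocritical :: "'a set \<Rightarrow> bool" where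
  "cocritical Y \<longleftrightarrow> Y \<subseteq> V \<and> slack (V - Y) = 1"

lemma arm_cocritical:
  assumes "node G v" "arm v z L"
  shows "cocritical L"
proof -
  have L: "L \<subseteq> V" "v \<notin> L" "L \<inter> nbrs v = {z}" "slack (V - insert v L) = 1"
    using assms by (auto simp: arm_def)
  have "insert v (V - insert v L) = V - L" using L assms by (auto simp: node_iff)
  moreover have "nbrs v \<inter> (V - insert v L) = nbrs v - {z}"
    using L nbrs_sub[of v] nbrs_irrefl[of v] by auto
  moreover have "z \<in> nbrs v" using L by auto
  then have "card (nbrs v - {z}) = 2" using assms by (simp add: node_iff)
  ultimately show ?thesis
    using slack_insert[of v "V - insert v L"] L by (simp add: cocritical_def)
qed

text \<open>Together with \<open>slack_remove_node\<close>: the cocritical sets with one vertex are the nodes.\<close>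

lemma cocritical_singleton:
  assumes "cocritical {t}"
  shows "node G t"
  using assms slack_remove[of t] by (auto simp: cocritical_def node_def)

text \<open>Nodes are cocritical singletons, so minimality is only asked for among sets with at least two
  vertices.\<close>

definition min_cocritical :: "'a set \<Rightarrow> bool" where
  "min_cocritical Y \<longleftrightarrow> cocritical Y \<and> card Y \<ge> 2 \<and>
     (\<forall>Z. cocritical Z \<and> Z \<subset> Y \<longrightarrow> card Z \<le> 1)"

lemma min_cocritical_exists:
  assumes "cocritical L" "card L \<ge> 2"
  obtains Y where "min_cocritical Y" "Y \<subseteq> L"
proof -
  let ?S = "{Y. Y \<subseteq> L \<and> cocritical Y \<and> card Y \<ge> 2}"
  have "finite L" using assms finite_sub by (simp add: cocritical_def)
  then have "finite ?S" by simp
  moreover have "L \<in> ?S" using assms by simp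
  ultimately have "\<exists>Y\<in>?S. Y \<subseteq> L \<and> (\<forall>Z\<in>?S. Z \<subseteq> Y \<longrightarrow> Y = Z)"
    by (rule finite_has_minimal2)
  then obtain Y where Y: "Y \<in> ?S" and least: "\<And>Z. Z \<in> ?S \<Longrightarrow> Z \<subseteq> Y \<Longrightarrow> Y = Z"
    by auto
  have "card Z \<le> 1" if Z: "cocritical Z" "Z \<subset> Y" for Z
  proof (rule ccontr)
    assume "\<not> card Z \<le> 1"
    then have "Z \<in> ?S" using Z Y(1) by auto
    then show False using least[of Z] Z(2) by blast
  qed
  then show thesis using that[of Y] Y by (auto simp: min_cocritical_def)
qed

lemma cocritical_Int:
  assumes "cocritical Y" "A \<subseteq> V" "slack A = 1" "(V - Y) \<inter> A \<noteq> {}" "(V - Y) \<union> A \<noteq> V"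
  shows "cocritical (Y - A)"
proof -
  have "V - (Y - A) = (V - Y) \<union> A" using assms by (auto simp: cocritical_def)
  then show ?thesis using critical_Un(1)[of "V - Y" A] assms by (auto simp: cocritical_def)
qed

lemma slack_cocritical_remove:
  assumes "cocritical Y" "v \<in> Y" "node G v"
  shows "slack (V - (Y - {v})) = int (card (nbrs v \<inter> Y))"
proof -
  have Y: "Y \<subseteq> V" using assms by (simp add: cocritical_def)
  have "V - (Y - {v}) = insert v (V - Y)" using assms Y by auto
  moreover have "(nbrs v \<inter> Y) \<union> (nbrs v \<inter> (V - Y)) = nbrs v" using nbrs_sub[of v] by auto
  then have "card (nbrs v \<inter> Y) + card (nbrs v \<inter> (V - Y)) = 3"
    using card_Un_disjoint[of "nbrs v \<inter> Y" "nbrs v \<inter> (V - Y)"] assms(3) by (auto simp: node_iff)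
  ultimately show ?thesis
    using slack_insert[of v "V - Y"] assms by (simp add: cocritical_def)
qed

text \<open>Uncrossing \<open>V - Y\<close> with the blocking set of an arm \<open>L\<close> at \<open>v\<close> shows that \<open>Y\<close> meets
  \<open>insert v L\<close> in a cocritical set, by minimality in \<open>{v}\<close> or in all of \<open>Y\<close>. Some
  neighbour \<open>z\<close> of \<open>v\<close> lies in \<open>Y\<close>, and taking its arm gives \<open>Y \<subseteq> insert v L\<close>. So \<open>v\<close>
  has only one neighbour in \<open>Y\<close>, its removal keeps \<open>Y\<close> cocritical, and minimality leaves
  only \<open>z\<close>.\<close>

lemma min_cocritical_open:
  assumes Y: "min_cocritical Y" and v: "open_node v" "v \<in> Y"
  obtains z where "Y = {v, z}" "node G z" "z \<in> nbrs v"
proof -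
  have nv: "node G v" using v by (simp add: open_node_def)
  have coY: "cocritical Y" "card Y \<ge> 2" and YV: "Y \<subseteq> V"
    and minY: "\<And>Z. cocritical Z \<Longrightarrow> Z \<subset> Y \<Longrightarrow> card Z \<le> 1"
    using Y by (auto simp: min_cocritical_def cocritical_def)
  have finY: "finite Y" using YV finite_sub by blast
  have meet: "Y \<inter> insert v L = {v} \<or> Y \<subseteq> insert v L"
    if L: "arm v z L" and M: "(V - Y) \<inter> (V - insert v L) \<noteq> {}" for z L
  proof -
    let ?A = "V - insert v L"
    have "(V - Y) \<union> ?A \<noteq> V" using v nv by (auto simp: node_iff)
    then have "cocritical (Y - ?A)"
      using cocritical_Int[of Y ?A] coY L M by (auto simp: arm_def)
    moreover have YA: "Y - ?A = Y \<inter> insert v L" using YV by auto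
    ultimately have co: "cocritical (Y \<inter> insert v L)" by simp
    show ?thesis
    proof (cases "Y \<inter> insert v L = Y")
      case False
      then have "card (Y \<inter> insert v L) \<le> 1" using minY[OF co] by blast
      then have "Y \<inter> insert v L = {v}" using v finY
        by (intro card_le1_eq_singleton) auto
      then show ?thesis by simp
    qed auto
  qed
  \<comment> \<open>If \<open>V - Y\<close> misses the blocking set, it lies in \<open>L\<close>; then \<open>Y\<close> contains the other two arms at \<open>v\<close>, and by minimality each of them would be \<open>Y - {v}\<close>, but arms at different neighbours are disjoint.\<close>
  have all: "Y \<inter> insert v L = {v} \<or> Y \<subseteq> insert v L" if L: "arm v z L" for z L
  proof (cases "(V - Y) \<inter> (V - insert v L) = {}")
    case True
    then have XL: "V - Y \<subseteq> L" using v by auto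
    have zN: "z \<in> nbrs v" using L by (auto simp: arm_def)
    obtain a b where N: "nbrs v = {z, a, b}" "z \<noteq> a" "z \<noteq> b" "a \<noteq> b"
      using nbrs3_at[OF nv zN] by metis
    obtain La where La: "arm v a La" using arm_exists[OF v(1), of a] N by auto
    obtain Lb where Lb: "arm v b Lb" using arm_exists[OF v(1), of b] N by auto
    have disj: "L \<inter> La = {}" "L \<inter> Lb = {}" "La \<inter> Lb = {}"
      using arms_disjoint[OF nv] L La Lb N by auto
    have X: "V - Y \<noteq> {}" using coY by (auto simp: cocritical_def)
    have Xv: "v \<notin> V - Y" using v by simp
    have "(V - Y) \<inter> (V - insert v La) \<noteq> {}" "(V - Y) \<inter> (V - insert v Lb) \<noteq> {}"
      using XL disj X Xv by blast+
    then have ab: "Y \<inter> insert v La = {v} \<or> Y \<subseteq> insert v La" "Y \<inter> insert v Lb = {v} \<or> Y \<subseteq> insert v Lb"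
      using meet La Lb by auto
    have aL: "a \<in> La" "b \<in> Lb" using La Lb by (auto simp: arm_def)
    then have "a \<in> Y" "b \<in> Y" using XL disj La Lb by (auto simp: arm_def)
    moreover have "a \<noteq> v" "b \<noteq> v" using N nbrs_irrefl[of v] by auto
    ultimately have "Y \<subseteq> insert v La" "Y \<subseteq> insert v Lb" using ab aL by blast+
    then have False using \<open>a \<in> Y\<close> \<open>a \<noteq> v\<close> disj by blast
    then show ?thesis ..
  qed (use meet L in blast)
  have "slack (V - (Y - {v})) \<ge> 1"
  proof (rule slack_pos)
    show "V - (Y - {v}) \<noteq> {}" using nv v by (auto simp: node_iff)
    have "\<not> Y \<subseteq> {v}" using coY(2) card_mono[of "{v}" Y] by auto
    then show "V - (Y - {v}) \<noteq> V" using YV by auto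
  qed simp
  then have "card (nbrs v \<inter> Y) \<ge> 1" using slack_cocritical_remove[OF coY(1) v(2) nv] by simp
  then have "nbrs v \<inter> Y \<noteq> {}" by auto
  then obtain z where z: "z \<in> nbrs v" "z \<in> Y" by blast
  obtain L where L: "arm v z L" using arm_exists[OF v(1) z(1)] by metis
  have zL: "L \<inter> nbrs v = {z}" using L by (simp add: arm_def)
  have "z \<noteq> v" "z \<in> L" using zL z(1) nbrs_irrefl[of v] by auto
  then have "Y \<inter> insert v L \<noteq> {v}" using z(2) by auto
  then have "Y \<subseteq> insert v L" using all[OF L] by simp
  then have "nbrs v \<inter> Y \<subseteq> L \<inter> nbrs v" using nbrs_irrefl[of v] by auto
  then have "nbrs v \<inter> Y = {z}" using zL z by auto
  then have "cocritical (Y - {v})"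
    using slack_cocritical_remove[OF coY(1) v(2) nv] YV by (auto simp: cocritical_def)
  then have c1: "card (Y - {v}) \<le> 1" using minY v by blast
  have "z \<in> Y - {v}" using z by auto
  then have "Y - {v} = {z}" using c1 finY
    by (intro card_le1_eq_singleton) auto
  moreover have "node G z" using cocritical_singleton \<open>cocritical (Y - {v})\<close> calculation by simp
  ultimately show thesis using that[of z] v z by auto
qed

text \<open>The subgraph induced by the nodes is a forest. Indeed, if every vertex of \<open>W\<close> has two neighbours
  in \<open>W\<close>, at most \<open>|W|\<close> edges leave \<open>W\<close>, whereas the excess of \<open>W\<close> is \<open>-|W|\<close>; together
  these give slack at most 0 for \<open>V - W\<close>.\<close>

lemma leaf_node:
  assumes "W \<noteq> {}" "W \<subset> V" and nodes: "\<And>u. u \<in> W \<Longrightarrow> node G u"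
  shows "\<exists>u\<in>W. card (nbrs u \<inter> W) \<le> 1"
proof (rule ccontr)
  assume "\<not> ?thesis"
  then have two: "card (nbrs u \<inter> W) \<ge> 2" if "u \<in> W" for u using that by fastforce
  have W: "finite W" "W \<subseteq> V" using assms finite_sub by auto
  have out: "card (nbrs u - W) \<le> 1" if "u \<in> W" for u
  proof -
    have "card (nbrs u) = card (nbrs u \<inter> W) + card (nbrs u - W)"
      using card_Int_Diff[of "nbrs u" W] by simp
    then show ?thesis using two[OF that] nodes[OF that] by (simp add: node_iff)
  qed
  let ?F = "cross W (V - W)"
  have "?F \<subseteq> (\<Union>u\<in>W. (\<lambda>x. {u, x}) ` (nbrs u - W))"
  proof
    fix e assume e: "e \<in> ?F"
    then have "e \<in> E" by (simp add: cross_def)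
    then obtain a b where ab: "e = {a, b}" "b \<in> nbrs a" "a \<in> nbrs b" using edge_endpoints by metis
    then have "(a \<in> W \<and> b \<notin> W) \<or> (b \<in> W \<and> a \<notin> W)" using e nbrs_V by (auto simp: cross_def)
    then show "e \<in> (\<Union>u\<in>W. (\<lambda>x. {u, x}) ` (nbrs u - W))" using ab by (auto simp: insert_commute)
  qed
  then have "card ?F \<le> card (\<Union>u\<in>W. (\<lambda>x. {u, x}) ` (nbrs u - W))"
    using W by (intro card_mono) auto
  also have "\<dots> \<le> (\<Sum>u\<in>W. card ((\<lambda>x. {u, x}) ` (nbrs u - W)))" using W by (intro card_UN_le) auto
  also have "\<dots> \<le> (\<Sum>u\<in>W. 1)"
    by (intro sum_mono order_trans[OF card_image_le out]) auto
  finally have F: "card ?F \<le> card W" by simp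
  have "excess W = (\<Sum>u\<in>W. -1)" unfolding excess_def
    using nodes by (intro sum.cong) (auto simp: node_def)
  then have "slack (V - W) - slack W = - int (card W)" using excess_slack W by simp
  then have "slack (V - W) \<le> 0" using F card_boundary[OF W(2)] by linarith
  then show False using slack_pos[of "V - W"] assms by fastforce
qed

end
lemma card_fibres:
  assumes "finite S" "finite A"
  shows "(\<Sum>y\<in>A. card {v \<in> S. b v = y}) = card {v \<in> S. b v \<in> A}"
proof -
  have "{v \<in> S. b v \<in> A} = (\<Union>y\<in>A. {v \<in> S. b v = y})" by auto
  then show ?thesis using assms by (simp add: card_UN_disjoint disjoint_iff)
qed

context circuit_without_admissible begin

text \<open>Otherwise the open nodes are closed under adjacency and make up the graph, but the average degree
  of a circuit is 4.\<close>

lemma open_node_nonnode_nbr: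
  assumes "open_node v"
  obtains u t where "open_node u" "t \<in> nbrs u" "\<not> node G t"
proof -
  have "\<exists>u t. open_node u \<and> t \<in> nbrs u \<and> \<not> node G t"
  proof (rule ccontr)
    assume none: "\<not> ?thesis"
    let ?W = "{u. open_node u}"
    have WV: "?W \<subseteq> V" by (auto simp: open_node_def node_iff)
    have "nbrs u \<subseteq> ?W \<union> {}" if u: "u \<in> ?W" for u
    proof
      fix t assume t: "t \<in> nbrs u"
      then have "node G t" using none u by blast
      moreover have "node G u" using u by (simp add: open_node_def)
      ultimately show "t \<in> ?W \<union> {}"
        using adjacent_nodes_open[of t u] t nbrs_sym[of t u] by simp
    qed
    then have VW: "V = ?W \<union> {}" using assms WV by (intro no_small_separator) auto
    have "excess V = (\<Sum>u\<in>V. -1)" unfolding excess_def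
    proof (rule sum.cong)
      fix u assume "u \<in> V"
      then have "node G u" using VW by (auto simp: open_node_def)
      then show "int (degree G u) - 4 = -1" by (simp add: node_def)
    qed simp
    then have "card V = 0" using excess_slack[of V] by simp
    then show False using assms WV by auto
  qed
  then show thesis using that by blast
qed

text \<open>Take a leaf \<open>u\<close> of the forest of adjacent nodes in \<open>L\<close>. If both its other neighbours lie outside
  \<open>L\<close>, then \<open>L - {u}\<close> is a smaller arm at \<open>t\<close>. Otherwise some neighbour \<open>x\<close> in \<open>L\<close> of \<open>u\<close> is not
  a node; uncrossing an arm of \<open>u\<close> at \<open>x\<close> with \<open>L\<close> gives a smaller arm inside \<open>L\<close>, unless that arm
  contains \<open>V - L\<close>. In that case the third neighbour also lies in \<open>L\<close> and is no node, and the
  same holds for its arm, although the two arms are disjoint.\<close>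

lemma minimal_arm_nodes:
  assumes v: "open_node v" and t: "\<not> node G t" and L: "arm v t L"
    and min: "\<And>v' t' L'. open_node v' \<Longrightarrow> \<not> node G t' \<Longrightarrow> arm v' t' L' \<Longrightarrow> card L \<le> card L'"
    and ab: "a \<in> L" "node G a" "b \<in> L" "node G b" "b \<in> nbrs a"
  shows False
proof -
  let ?W = "{u \<in> L. node G u \<and> (\<exists>w\<in>L. w \<in> nbrs u \<and> node G w)}"
  have nv: "node G v" using v by (simp add: open_node_def)
  have LV: "L \<subseteq> V" "v \<notin> L" "L \<inter> nbrs v = {t}" "slack (V - insert v L) = 1"
    using L by (auto simp: arm_def)
  have finL: "finite L" using LV finite_sub by blast
  have "?W \<noteq> {}" using ab by blast
  moreover have "?W \<subset> V" using LV nv by (auto simp: node_iff)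
  ultimately obtain u where u: "u \<in> ?W" "card (nbrs u \<inter> ?W) \<le> 1"
    using leaf_node[of ?W] by blast
  then obtain w where w: "w \<in> L" "w \<in> nbrs u" "node G w" by blast
  have nu: "node G u" and uL: "u \<in> L" using u by auto
  have "w \<in> ?W" using w nu uL nbrs_sym[of u w] by auto
  have "nbrs u \<inter> ?W = {w}"
    by (rule card_le1_eq_singleton) (use u(2) w \<open>w \<in> ?W\<close> in auto)
  then have one: "x = w" if "x \<in> nbrs u" "x \<in> L" "node G x" for x
    using that nu uL nbrs_sym[of u x] by blast
  obtain p q where N: "nbrs u = {w, p, q}" "w \<noteq> p" "w \<noteq> q" "p \<noteq> q"
    using nbrs3_at[OF nu w(2)] by metis
  have open_u: "open_node u" using adjacent_nodes_open[OF nu w(3,2)] .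
  let ?M = "V - L"
  have M: "slack ?M = 1" using arm_cocritical[OF nv L] by (simp add: cocritical_def)
  have smaller: False if L': "arm v' t' L'" "open_node v'" "\<not> node G t'" "L' \<subseteq> L - {u}" for v' t' L'
  proof -
    have "card L' \<le> card (L - {u})" using L'(4) finL by (intro card_mono) auto
    also have "\<dots> < card L" using uL finL by (intro card_Diff1_less)
    finally show False using min[OF L'(2,3,1)] by simp
  qed
  have inside: "V - insert u Lp \<subseteq> L" if Lp: "arm u x Lp" and x: "x \<in> L" "x \<noteq> w" for x Lp
  proof (rule ccontr)
    let ?A = "V - insert u Lp"
    assume "\<not> ?A \<subseteq> L"
    then have meet: "?M \<inter> ?A \<noteq> {}" by auto
    have un: "?M \<union> ?A \<noteq> V" using uL LV by auto
    have A: "slack ?A = 1" "Lp \<inter> nbrs u = {x}" "Lp \<subseteq> V" using Lp by (auto simp: arm_def)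
    have "slack (?M \<union> ?A) = 1" using critical_Un(1)[of ?M ?A] M A meet un by auto
    moreover have "?M \<union> ?A = V - insert u (Lp \<inter> L - {u})" using uL by auto
    ultimately have "arm u x (Lp \<inter> L - {u})"
      using A x LV nbrs_irrefl[of u] by (auto simp: arm_def)
    moreover have "x \<in> nbrs u" using A by auto
    then have "\<not> node G x" using one x by blast
    ultimately show False using smaller open_u by blast
  qed
  have fromp: False if x: "x \<in> nbrs u" "x \<in> L" "x \<noteq> w" and y: "y \<in> nbrs u" "y \<noteq> x" "y \<noteq> w" for x y
  proof -
    obtain Lx where Lx: "arm u x Lx" using arm_exists[OF open_u x(1)] by metis
    obtain Ly where Ly: "arm u y Ly" using arm_exists[OF open_u y(1)] by metis
    have Ax: "V - insert u Lx \<subseteq> L" using inside[OF Lx x(2,3)] .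
    have "y \<in> V - insert u Lx" using arm_rest_nbrs[OF Lx] y by auto
    then have "y \<in> L" using Ax by auto
    then have Ay: "V - insert u Ly \<subseteq> L" using inside[OF Ly] y by simp
    have "Lx \<inter> Ly = {}" using arms_disjoint[OF nu Lx Ly] y by simp
    then have "V \<subseteq> L" using Ax Ay uL by auto
    then show False using LV nv by (auto simp: node_iff)
  qed
  have pq: "p \<notin> L" "q \<notin> L" using fromp[of p q] fromp[of q p] N by auto
  have "u \<noteq> t" using nu t by auto
  have "u \<notin> nbrs v" using \<open>u \<noteq> t\<close> uL LV(3) by auto
  then have "v \<notin> nbrs u" using nbrs_sym by simp
  then have NA: "nbrs u \<inter> (V - insert v L) = {p, q}"
    using N pq w nbrs_sub[of u] by auto
  have "insert u (V - insert v L) = V - insert v (L - {u})"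
    using uL LV by auto
  moreover have "slack (insert u (V - insert v L)) = 1"
    using slack_insert[of u "V - insert v L"] NA N uL LV(4) by simp
  ultimately have "arm v t (L - {u})"
    using LV \<open>u \<noteq> t\<close> by (auto simp: arm_def)
  then show False using smaller v t by blast
qed

text \<open>If there is an open node, the required set is found inside a smallest arm at a neighbour that is
  not a node.\<close>

lemma min_cocritical_without_open:
  assumes "cocritical L" "card L \<ge> 2"
  obtains Y where "min_cocritical Y" "\<And>v. v \<in> Y \<Longrightarrow> \<not> open_node v"
proof (cases "\<exists>v. open_node v")
  case False
  then show thesis using min_cocritical_exists[OF assms] that by blast
next
  case True
  then obtain v0 t0 where 0: "open_node v0" "t0 \<in> nbrs v0" "\<not> node G t0"
    using open_node_nonnode_nbr by metis
  then obtain L0 where L0: "arm v0 t0 L0" using arm_exists by metis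
  define P where "P = (\<lambda>(v, t, L). open_node v \<and> \<not> node G t \<and> arm v t L)"
  have "P (v0, t0, L0)" using 0 L0 by (simp add: P_def)
  from ex_has_least_nat[of P, OF this, of "\<lambda>m. card (snd (snd m))"]
  obtain m where m: "P m" "\<And>m'. P m' \<Longrightarrow> card (snd (snd m)) \<le> card (snd (snd m'))" by blast
  obtain v t L where mm: "m = (v, t, L)" by (cases m)
  have v: "open_node v" "\<not> node G t" "arm v t L" using m(1) by (auto simp: P_def mm)
  have min: "card L \<le> card L'" if "open_node v'" "\<not> node G t'" "arm v' t' L'" for v' t' L'
    using m(2)[of "(v', t', L')"] that by (auto simp: P_def mm)
  have "node G v" using v(1) by (simp add: open_node_def)
  then have co: "cocritical L" using arm_cocritical v(3) by simp
  have tL: "t \<in> L" using v(3) by (auto simp: arm_def)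
  have finL: "finite L" using co finite_sub by (simp add: cocritical_def)
  have "card L \<ge> 2"
  proof (rule ccontr)
    assume "\<not> card L \<ge> 2"
    then have "L = {t}" using card_le1_eq_singleton[OF finL _ tL] by simp
    then show False using cocritical_singleton co v(2) by simp
  qed
  then obtain Y where Y: "min_cocritical Y" "Y \<subseteq> L" using min_cocritical_exists[OF co] by metis
  have "\<not> open_node w" if w: "w \<in> Y" for w
  proof
    assume o: "open_node w"
    obtain z where z: "Y = {w, z}" "node G z" "z \<in> nbrs w"
      using min_cocritical_open[OF Y(1) o w] by metis
    show False
    proof (rule minimal_arm_nodes[OF v, where a = w and b = z])
      show "card L \<le> card L'" if "open_node v'" "\<not> node G t'" "arm v' t' L'" for v' t' L'
        using min that by blast
    qed (use z Y(2) o in \<open>auto simp: open_node_def\<close>)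
  qed
  then show thesis using that Y(1) by blast
qed

section \<open>Discharging over the cliques at nodes\<close>

definition hood :: "'a \<Rightarrow> 'a set" where
  "hood v = insert v (nbrs v)"

lemma hood_V: "node G v \<Longrightarrow> hood v \<subseteq> V"
  using nbrs_sub[of v] by (auto simp: hood_def node_iff)

lemma card_hood: "node G v \<Longrightarrow> card (hood v) = 4"
  by (simp add: hood_def node_iff)

lemma finite_hood [simp]: "finite (hood v)"
  by (simp add: hood_def)

lemma hood_adj: "clique_node v \<Longrightarrow> a \<in> hood v \<Longrightarrow> b \<in> hood v \<Longrightarrow> a \<noteq> b \<Longrightarrow> b \<in> nbrs a"
  by (auto simp: hood_def clique_node_def nbrs_sym)

lemma slack_hood_sub:
  assumes "clique_node v" "S \<subseteq> hood v"
  shows "2 * slack S = int (card S) * (5 - int (card S))"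
proof (rule slack_clique)
  show "S \<subseteq> V" using assms hood_V[of v] by (auto simp: clique_node_def)
  show "b \<in> nbrs a" if "a \<in> S" "b \<in> S" "a \<noteq> b" for a b
    using hood_adj[OF assms(1)] assms(2) that by blast
qed

lemma slack_hood: "clique_node v \<Longrightarrow> slack (hood v) = 2"
  using slack_hood_sub[of v "hood v"] card_hood[of v] by (simp add: clique_node_def)

text \<open>Cliques on 1, 2, 3, 4 vertices have slack 2, 3, 3, 2.\<close>

lemma slack_hood_ge:
  assumes "clique_node v" "S \<subseteq> hood v" "card S \<ge> 1"
  shows "slack S \<ge> 2" "card S \<in> {2, 3} \<Longrightarrow> slack S = 3"
proof -
  have "card S \<le> 4"
    using assms card_hood[of v] card_mono[OF finite_hood assms(2)] by (simp add: clique_node_def)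
  then have "card S = 1 \<or> card S = 2 \<or> card S = 3 \<or> card S = 4" using assms(3) by linarith
  then show "slack S \<ge> 2" "card S \<in> {2, 3} \<Longrightarrow> slack S = 3"
    using slack_hood_sub[OF assms(1,2)] by auto
qed

lemma degree_ge4: "u \<in> V \<Longrightarrow> \<not> node G u \<Longrightarrow> degree G u \<ge> 4"
  using degree_ge3[of u] by (auto simp: node_def)

text \<open>A node \<open>v\<close> of \<open>Y\<close> has at least two neighbours \<open>x\<close>, \<open>y\<close> in \<open>Y\<close>, since otherwise \<open>Y - {v}\<close> would be
  cocritical. If the third neighbour \<open>z\<close> were outside, then joining the clique of \<open>v\<close> to \<open>V - Y\<close> keeps
  the slack at most 1, so at most one vertex of \<open>Y\<close> remains. As \<open>x\<close> and \<open>y\<close> have degree at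
  least 4, each has a further neighbour; this produces too many edges between the two parts, or a
  node \<open>w\<close> adjacent to both, and then two vertices separate the graph.\<close>

lemma min_cocritical_nbrs:
  assumes Y: "min_cocritical Y" and clique: "\<And>v. v \<in> Y \<Longrightarrow> \<not> open_node v"
    and v: "v \<in> Y" "node G v"
  shows "nbrs v \<subseteq> Y"
proof (rule ccontr)
  assume "\<not> nbrs v \<subseteq> Y"
  then obtain z where z: "z \<in> nbrs v" "z \<notin> Y" by auto
  have coY: "cocritical Y" "card Y \<ge> 2" and YV: "Y \<subseteq> V"
    and minY: "\<And>Z. cocritical Z \<Longrightarrow> Z \<subset> Y \<Longrightarrow> card Z \<le> 1"
    using Y by (auto simp: min_cocritical_def cocritical_def)
  have finY: "finite Y" using YV finite_sub by blast
  have cl: "clique_node u" if "u \<in> Y" "node G u" for u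
    using node_cases[OF that(2)] clique[OF that(1)] by blast
  have cv: "clique_node v" using cl v by simp
  let ?X = "V - Y"
  have X: "slack ?X = 1" "?X \<noteq> {}" using coY by (auto simp: cocritical_def)
  have X5: "card ?X \<ge> 5" using critical_large[of ?X] X by auto
  have two: "card (nbrs v \<inter> Y) \<ge> 2"
  proof (rule ccontr)
    assume less: "\<not> ?thesis"
    have "\<not> Y \<subseteq> {v}" using coY(2) card_mono[of "{v}" Y] by auto
    then have "slack (V - (Y - {v})) \<ge> 1" using X YV by (intro slack_pos) auto
    then have eq: "slack (V - (Y - {v})) = 1" "card (nbrs v \<inter> Y) = 1"
      using slack_cocritical_remove[OF coY(1) v] less by auto
    then have co: "cocritical (Y - {v})" using YV by (auto simp: cocritical_def)
    then have c1: "card (Y - {v}) \<le> 1" using minY v by blast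
    obtain w where w: "nbrs v \<inter> Y = {w}" using eq(2) by (auto simp: card_1_singleton_iff)
    then have "w \<in> Y - {v}" using nbrs_irrefl[of v] by auto
    then have "Y - {v} = {w}" using c1 finY by (intro card_le1_eq_singleton) auto
    then have "node G w" using co cocritical_singleton by simp
    then show False using clique_node_nbrs[OF cv] w by auto
  qed
  obtain x y where N: "nbrs v = {z, x, y}" "z \<noteq> x" "z \<noteq> y" "x \<noteq> y"
    using nbrs3_at[OF v(2) z(1)] by metis
  have "{x, y} = nbrs v \<inter> Y"
  proof (rule sym, rule card_seteq)
    show "nbrs v \<inter> Y \<subseteq> {x, y}" using N z by auto
    show "card {x, y} \<le> card (nbrs v \<inter> Y)" using two N by simp
  qed simp
  then have xyY: "x \<in> Y" "y \<in> Y" by auto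
  have vxyz: "v \<noteq> x" "v \<noteq> y" "v \<noteq> z" using N nbrs_irrefl[of v] by auto
  let ?K = "hood v" and ?R = "Y - {v, x, y}"
  have K: "?K = {v, x, y, z}" using N by (auto simp: hood_def)
  have zV: "z \<in> V" using z nbrs_V by auto
  have "\<not> node G x" "\<not> node G y" using clique_node_nbrs[OF cv] N by auto
  then have deg: "card (nbrs x) \<ge> 4" "card (nbrs y) \<ge> 4"
    using degree_ge4 xyY YV degree_nbrs by auto
  have outer: "\<exists>a. a \<in> nbrs u \<and> a \<notin> ?K" if u: "card (nbrs u) \<ge> 4" "u \<in> {x, y}" for u
  proof (rule ccontr)
    assume "\<not> ?thesis"
    then have "nbrs u \<subseteq> ?K - {u}" using nbrs_irrefl[of u] by auto
    then have "card (nbrs u) \<le> card (?K - {u})" by (intro card_mono) auto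
    then show False using u card_hood[OF v(2)] K by auto
  qed
  obtain x' where x': "x' \<in> nbrs x" "x' \<notin> ?K" using outer[of x] deg by auto
  obtain y' where y': "y' \<in> nbrs y" "y' \<notin> ?K" using outer[of y] deg by auto
  have x'y'V: "x' \<in> V" "y' \<in> V" using x' y' nbrs_V by auto
  have un: "?X \<union> ?K = V - ?R" "?X \<inter> ?K = {z}" using K xyY v z YV zV by auto
  have mod: "slack (V - ?R) + 2 + int (card (cross ?X ?K)) = 3"
    using slack_modular[of ?X ?K] hood_V[OF v(2)] X slack_hood[OF cv] unfolding un by simp
  have cr: "{u, a} \<in> cross ?X ?K" if "a \<in> nbrs u" "a \<notin> ?K" "a \<in> ?X" "u \<in> {x, y}" for u a
    using that K xyY by (auto simp: cross_def nbrs_def)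
  show False
  proof (cases "?R = {}")
    case True
    have "x' \<in> ?X" "y' \<in> ?X" using True x' y' x'y'V K by auto
    then have sub: "{{x, x'}, {y, y'}} \<subseteq> cross ?X ?K" using cr x' y' by auto
    have "{x, x'} \<noteq> {y, y'}" using N y' K by (auto simp: doubleton_eq_iff)
    then have "card (cross ?X ?K) \<ge> 2" using card_mono[OF finite_cross sub] by simp
    then show False using mod True by simp
  next
    case False
    then have "slack (V - ?R) \<ge> 1" using v YV by (intro slack_pos) auto
    then have "slack (V - ?R) = 1 \<and> card (cross ?X ?K) = 0" using mod by linarith
    then have eq: "slack (V - ?R) = 1" "cross ?X ?K = {}" by auto
    then have co: "cocritical ?R" using YV by (auto simp: cocritical_def)
    then have "card ?R \<le> 1" using minY[of ?R] v by blast
    obtain w where w: "w \<in> ?R" using False by auto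
    then have R: "?R = {w}" using finY \<open>card ?R \<le> 1\<close> by (intro card_le1_eq_singleton) auto
    then have nw: "node G w" using co cocritical_singleton by simp
    have cw: "clique_node w" using cl nw w by auto
    have noX: "a = w" if "a \<in> nbrs u" "a \<notin> ?K" "u \<in> {x, y}" for u a
    proof -
      have "a \<notin> ?X" using cr[of a u] that eq by auto
      then have "a \<in> ?R" using that nbrs_V[of a u] K by auto
      then show ?thesis using R by auto
    qed
    have "x' = w" "y' = w" using noX x' y' by auto
    then have xw: "x \<in> nbrs w" "y \<in> nbrs w" using x' y' nbrs_sym by auto
    obtain z' where z': "nbrs w = {x, y, z'}" "x \<noteq> z'" "y \<noteq> z'"
      using nbrs3_at2[OF nw xw N(4)] by metis
    have "v \<noteq> z'" using clique_node_nbrs[OF cw] z' v by auto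
    have "w \<noteq> z'" using z' nbrs_irrefl[of w] by auto
    have "V = {v, x, y, w} \<union> {z, z'}"
    proof (rule no_small_separator)
      show "{v, x, y, w} \<inter> {z, z'} = {}"
        using \<open>v \<noteq> z'\<close> \<open>w \<noteq> z'\<close> z' N vxyz w z by auto
      show "{z, z'} \<subseteq> V" using zV nbrs_V[of z' w] z' by auto
      show "{v, x, y, w} \<subseteq> V" using v xyY w YV by auto
      show "nbrs u \<subseteq> {v, x, y, w} \<union> {z, z'}" if "u \<in> {v, x, y, w}" for u
      proof
        fix a assume a: "a \<in> nbrs u"
        show "a \<in> {v, x, y, w} \<union> {z, z'}"
        proof (cases "u \<in> {x, y}")
          case True then show ?thesis using noX[OF a] K by auto
        next
          case False then show ?thesis using that a N z' by auto
        qed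
      qed
    qed (auto simp: card_insert_if)
    then have "?X \<subseteq> {z, z'}" using v xyY w by auto
    then have "card ?X \<le> card {z, z'}" by (intro card_mono) auto
    also have "\<dots> \<le> 2" by (auto simp: card_insert_if)
    finally show False using X5 by simp
  qed
qed

text \<open>Each clique sends three edges from its vertex in \<open>B\<close> to its other vertices, and distinct
  cliques share no edge, so at least \<open>3 |S|\<close> edges leave \<open>B\<close>.\<close>

lemma attached_hoods:
  assumes B: "B \<subseteq> V" and S: "finite S" "\<And>v. v \<in> S \<Longrightarrow> clique_node v"
    and one: "\<And>v. v \<in> S \<Longrightarrow> card (hood v \<inter> B) = 1"
    and sep: "\<And>v w. v \<in> S \<Longrightarrow> w \<in> S \<Longrightarrow> v \<noteq> w \<Longrightarrow> card (hood v \<inter> hood w) \<le> 1"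
  shows "excess B \<ge> 3 * int (card S) - 2 * slack B"
proof -
  let ?F = "\<lambda>v. {e \<in> cross B (V - B). e \<subseteq> hood v}"
  have three: "card (?F v) \<ge> 3" if v: "v \<in> S" for v
  proof -
    have nv: "node G v" using S(2)[OF v] by (simp add: clique_node_def)
    obtain b where b: "hood v \<inter> B = {b}" using one[OF v] by (auto simp: card_1_singleton_iff)
    then have bh: "b \<in> hood v" "b \<in> B" by auto
    have "(\<lambda>u. {b, u}) ` (hood v - {b}) \<subseteq> ?F v"
    proof
      fix e assume "e \<in> (\<lambda>u. {b, u}) ` (hood v - {b})"
      then obtain u where u: "e = {b, u}" "u \<in> hood v" "u \<noteq> b" by auto
      then have "u \<notin> B" using b by auto
      moreover have "u \<in> nbrs b" using hood_adj[OF S(2)[OF v] bh(1) u(2)] u(3) by simp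
      ultimately show "e \<in> ?F v"
        using u bh hood_V[OF nv] by (auto simp: cross_def nbrs_def)
    qed
    then have "card ((\<lambda>u. {b, u}) ` (hood v - {b})) \<le> card (?F v)" by (intro card_mono) auto
    moreover have "inj_on (\<lambda>u. {b, u}) (hood v - {b})" by (auto simp: inj_on_def doubleton_eq_iff)
    then have "card ((\<lambda>u. {b, u}) ` (hood v - {b})) = 3"
      using card_hood[OF nv] bh by (simp add: card_image)
    ultimately show ?thesis by simp
  qed
  have disj: "?F v \<inter> ?F w = {}" if vw: "v \<in> S" "w \<in> S" "v \<noteq> w" for v w
  proof (rule ccontr)
    assume "?F v \<inter> ?F w \<noteq> {}"
    then obtain e where e: "e \<in> E" "e \<subseteq> hood v \<inter> hood w" by (auto simp: cross_def)
    then have "card e \<le> card (hood v \<inter> hood w)" by (intro card_mono) auto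
    then show False using sep[OF vw] E_pairs[OF e(1)] by simp
  qed
  have "3 * card S = (\<Sum>v\<in>S. 3)" by simp
  also have "\<dots> \<le> (\<Sum>v\<in>S. card (?F v))" using three by (intro sum_mono) auto
  also have "\<dots> = card (\<Union>v\<in>S. ?F v)" using S(1) disj by (intro card_UN_disjoint[symmetric]) auto
  also have "\<dots> \<le> card (cross B (V - B))" by (intro card_mono) auto
  finally show ?thesis using card_boundary[OF B] excess_slack[OF B] by linarith
qed

text \<open>The clique of \<open>v\<close> has slack 2 and \<open>v\<close> itself contributes \<open>-1\<close> to the excess.\<close>

lemma hood_excess:
  assumes v: "clique_node v" and cut: "slack (hood v) + slack (V - hood v) \<ge> k"
  shows "(\<Sum>x\<in>nbrs v. int (degree G x) - 4) \<ge> k - 3"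
proof -
  have nv: "node G v" using v by (simp add: clique_node_def)
  have "excess (hood v) = (\<Sum>x\<in>nbrs v. int (degree G x) - 4) - 1"
    using nv by (simp add: excess_def hood_def node_def)
  then show ?thesis using excess_slack[OF hood_V[OF nv]] slack_hood[OF v] cut by linarith
qed

text \<open>Every node \<open>v\<close> in \<open>W\<close> sends its deficit 1 to the vertex \<open>b v\<close>; this is the excess that
  \<open>y\<close> keeps.\<close>

definition charge :: "'a set \<Rightarrow> ('a \<Rightarrow> 'a) \<Rightarrow> 'a \<Rightarrow> int" where
  "charge W b y = int (degree G y) - 4 - int (card {v \<in> W. b v = y})"

lemma sum_charge:
  assumes "finite W" "finite A"
  shows "(\<Sum>y\<in>A. charge W b y) = excess A - int (card {v \<in> W. b v \<in> A})"
  using card_fibres[OF assms, of b, symmetric]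
  by (simp add: charge_def excess_def sum_subtractf)

lemma excess_charge:
  assumes "finite Y" "W \<subseteq> Y" "\<And>v. v \<in> W \<Longrightarrow> node G v \<and> b v \<in> Y - W"
  shows "excess Y = (\<Sum>y\<in>Y - W. charge W b y)"
proof -
  have finW: "finite W" using assms finite_subset by blast
  have "excess W = (\<Sum>u\<in>W. -1)" unfolding excess_def
    using assms(3) by (intro sum.cong) (auto simp: node_def)
  then have "excess W = - int (card W)" by simp
  moreover have "excess Y = excess W + excess (Y - W)" unfolding excess_def
    using sum.subset_diff[OF assms(2,1), of "\<lambda>v. int (degree G v) - 4"] by simp
  moreover have "{v \<in> W. b v \<in> Y - W} = W" using assms(3) by auto
  ultimately show ?thesis using sum_charge[OF finW, of "Y - W" b] assms(1) by simp
qed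

lemma attached_degree:
  assumes y: "y \<in> V" and S: "finite S" "\<And>v. v \<in> S \<Longrightarrow> clique_node v \<and> y \<in> nbrs v"
    and sep: "\<And>v w. v \<in> S \<Longrightarrow> w \<in> S \<Longrightarrow> v \<noteq> w \<Longrightarrow> card (hood v \<inter> hood w) \<le> 1"
  shows "int (degree G y) \<ge> 3 * int (card S)"
proof -
  have "card (hood v \<inter> {y}) = 1" if v: "v \<in> S" for v
    using S(2)[OF v] by (simp add: hood_def)
  then have "excess {y} \<ge> 3 * int (card S) - 2 * slack {y}"
    using attached_hoods[of "{y}" S] S sep y by simp
  then show ?thesis by (simp add: excess_def)
qed

text \<open>With \<open>s\<close> donors at \<open>y\<close> the degree is at least \<open>3 s\<close>, and \<open>3 s - 4 \<ge> s\<close> for \<open>s \<ge> 2\<close>; for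
  \<open>s = 1\<close> the bound comes from the degree of the recipient.\<close>

lemma charge_nonneg:
  assumes y: "y \<in> V" "\<not> node G y" and W: "finite W" "\<And>v. v \<in> W \<Longrightarrow> clique_node v"
    and sep: "\<And>v w. v \<in> W \<Longrightarrow> w \<in> W \<Longrightarrow> v \<noteq> w \<Longrightarrow> card (hood v \<inter> hood w) \<le> 1"
    and b: "\<And>v. v \<in> W \<Longrightarrow> b v \<in> nbrs v \<and> degree G (b v) \<ge> 5"
  shows "charge W b y \<ge> 0"
proof -
  let ?S = "{v \<in> W. b v = y}"
  have "clique_node v \<and> y \<in> nbrs v" if "v \<in> ?S" for v using that W(2) b by auto
  then have att: "int (degree G y) \<ge> 3 * int (card ?S)"
    using attached_degree[of y ?S] y W(1) sep by auto
  have d5: "degree G y \<ge> 5" if "card ?S > 0"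
    using that b by (auto simp: card_gt_0_iff)
  consider "card ?S = 0" | "card ?S = 1" | "card ?S \<ge> 2" by linarith
  then show ?thesis
  proof cases
    case 1 then show ?thesis using degree_ge4[OF y] by (simp add: charge_def)
  next
    case 2 then show ?thesis using d5 by (simp add: charge_def)
  next
    case 3 then show ?thesis using att unfolding charge_def by linarith
  qed
qed

lemma heavy_nbr:
  assumes v: "clique_node v" and cut: "slack (hood v) + slack (V - hood v) \<ge> 4"
  shows "\<exists>x. x \<in> nbrs v \<and> degree G x \<ge> 5"
proof (rule ccontr)
  assume "\<not> ?thesis"
  then have "(\<Sum>x\<in>nbrs v. int (degree G x) - 4) \<le> (\<Sum>x\<in>nbrs v. 0)" by (intro sum_mono) force
  then show False using hood_excess[OF v cut] by simp
qed

text \<open>The excess of \<open>Y\<close> is \<open>1 - slack Y\<close>, which is at most \<open>-2\<close>. Discharging shows that it is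
  nonnegative. The nodes in critical subsets of \<open>Y\<close> are left alone, as the maximal critical
  subsets \<open>C\<close> are disjoint and have enough excess in total: with \<open>s\<close> cliques of other nodes
  attached, the excess is at least \<open>3 s - 2\<close>, and it is at least 2 because four edges leave \<open>C\<close>.\<close>

lemma no_clean_min_cocritical:
  assumes Y: "min_cocritical Y" and clique: "\<And>v. v \<in> Y \<Longrightarrow> \<not> open_node v"
    and cut: "\<And>S. S \<subseteq> V \<Longrightarrow> card S \<ge> 2 \<Longrightarrow> card (V - S) \<ge> 2 \<Longrightarrow> slack S + slack (V - S) \<ge> 4"
  shows False
proof -
  have coY: "cocritical Y" "card Y \<ge> 2" and YV: "Y \<subseteq> V"
    using Y by (auto simp: min_cocritical_def cocritical_def)
  have finY: "finite Y" using YV finite_sub by blast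
  have X: "slack (V - Y) = 1" "V - Y \<noteq> {}" using coY by (auto simp: cocritical_def)
  then have X5: "card (V - Y) \<ge> 5" using critical_large[of "V - Y"] by auto
  have cl: "clique_node u" if "u \<in> Y" "node G u" for u
    using node_cases[OF that(2)] clique[OF that(1)] by blast
  have hY: "hood u \<subseteq> Y" if "u \<in> Y" "node G u" for u
    using min_cocritical_nbrs[OF Y clique that] that by (auto simp: hood_def)
  have big: "card (V - C) \<ge> 2" if "C \<subseteq> Y" for C
    using card_mono[of "V - C" "V - Y"] that X5 by fastforce
  have pos: "slack C \<ge> 1" if "C \<subseteq> Y" "C \<noteq> {}" for C
    using that YV X by (intro slack_pos) auto
  define \<C> where "\<C> = {C. C \<subseteq> Y \<and> slack C = 1}"
  \<comment> \<open>Only nodes outside all critical subsets of \<open>Y\<close> send a charge; the cliques of two such nodes share no edge.\<close>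
  define W where "W = {v \<in> Y. node G v \<and> (\<forall>C\<in>\<C>. v \<notin> C)}"
  have fin: "finite \<C>" "finite W" using finY by (auto simp: \<C>_def W_def)
  have W: "node G v" "clique_node v" "v \<in> Y" "hood v \<subseteq> Y" if "v \<in> W" for v
    using that cl hY by (auto simp: W_def)
  have free: "C \<notin> \<C>" if "v \<in> W" "v \<in> C" for v C using that by (auto simp: W_def)
  have sepW: "card (hood v \<inter> hood w) \<le> 1" if vw: "v \<in> W" "w \<in> W" "v \<noteq> w" for v w
  proof (rule ccontr)
    assume "\<not> ?thesis"
    moreover have "w \<notin> nbrs v" using clique_node_nbrs[OF W(2)[OF vw(1)], of w] W(1)[OF vw(2)] by blast
    then have "hood v \<inter> hood w \<subseteq> nbrs v"
      using vw(3) nbrs_sym[of v w] by (auto simp: hood_def)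
    then have "card (hood v \<inter> hood w) \<le> 3"
      using card_mono[OF finite_nbrs] W(1)[OF vw(1)] by (metis node_iff)
    ultimately have "card (hood v \<inter> hood w) \<in> {2, 3}" by auto
    then have "slack (hood v \<inter> hood w) = 3"
      using slack_hood_ge(2)[OF W(2)[OF vw(1)], of "hood v \<inter> hood w"] by auto
    then have "slack (hood v \<union> hood w) \<le> 1"
      using slack_submodular[OF hood_V hood_V, OF W(1) W(1), OF vw(1,2)]
        slack_hood[OF W(2)[OF vw(1)]] slack_hood[OF W(2)[OF vw(2)]] by linarith
    moreover have sub: "hood v \<union> hood w \<subseteq> Y" using W(4) vw by auto
    moreover have vU: "v \<in> hood v \<union> hood w" by (simp add: hood_def)
    then have "hood v \<union> hood w \<noteq> {}" by auto
    then have "slack (hood v \<union> hood w) \<ge> 1" by (rule pos[OF sub])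
    ultimately have "hood v \<union> hood w \<in> \<C>" by (simp add: \<C>_def)
    then show False using free[OF vw(1) vU] by simp
  qed
  \<comment> \<open>Otherwise the union of \<open>C\<close> with the clique would have slack at most 0.\<close>
  have sepC: "card (hood v \<inter> C) \<le> 1" if v: "v \<in> W" and C: "C \<in> \<C>" for v C
  proof (rule ccontr)
    assume "\<not> ?thesis"
    moreover have "v \<notin> C" using free v C by blast
    then have "hood v \<inter> C \<subseteq> nbrs v" by (auto simp: hood_def)
    then have "card (hood v \<inter> C) \<le> 3"
      using card_mono[OF finite_nbrs] W(1)[OF v] by (metis node_iff)
    ultimately have "card (hood v \<inter> C) \<in> {2, 3}" by auto
    then have "slack (hood v \<inter> C) = 3"
      using slack_hood_ge(2)[OF W(2)[OF v], of "hood v \<inter> C"] by auto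
    moreover have CV: "C \<subseteq> Y" "slack C = 1" using C by (auto simp: \<C>_def)
    ultimately have "slack (hood v \<union> C) \<le> 0"
      using slack_submodular[OF hood_V[OF W(1)[OF v]], of C] slack_hood[OF W(2)[OF v]] YV by auto
    moreover have "hood v \<union> C \<subseteq> Y" "hood v \<union> C \<noteq> {}" using W(4)[OF v] CV by (auto simp: hood_def)
    ultimately show False using pos[of "hood v \<union> C"] by simp
  qed
  have "\<exists>x. x \<in> nbrs v \<and> degree G x \<ge> 5" if v: "v \<in> W" for v
    using heavy_nbr[OF W(2)[OF v]] cut[of "hood v"] card_hood[OF W(1)[OF v]] hood_V[OF W(1)[OF v]]
      big[OF W(4)[OF v]] by simp
  then obtain b where b: "\<And>v. v \<in> W \<Longrightarrow> b v \<in> nbrs v \<and> degree G (b v) \<ge> 5" by metis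
  have bY: "b v \<in> Y - W" if "v \<in> W" for v
    using b[OF that] W(4)[OF that] by (auto simp: hood_def W_def node_def)
  let ?wt = "charge W b"
  have exY: "excess Y = (\<Sum>y\<in>Y - W. ?wt y)"
    using W(1) bY by (intro excess_charge finY) (auto simp: W_def)
  define \<M> where "\<M> = {C \<in> \<C>. \<forall>D\<in>\<C>. C \<subseteq> D \<longrightarrow> C = D}"
  have block: "(\<Sum>y\<in>C. ?wt y) \<ge> 0" if C: "C \<in> \<C>" for C
  proof -
    have CY: "C \<subseteq> Y" "slack C = 1" "C \<subseteq> V" using C YV by (auto simp: \<C>_def)
    have finC: "finite C" using CY finY finite_subset by blast
    let ?S = "{v \<in> W. b v \<in> C}"
    have "card (hood v \<inter> C) = 1" if v: "v \<in> ?S" for v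
    proof -
      have "b v \<in> hood v \<inter> C" using v b by (auto simp: hood_def)
      then have "card (hood v \<inter> C) > 0" by (metis card_gt_0_iff empty_iff finite_Int finite_hood)
      then show ?thesis using sepC[OF _ C, of v] v by auto
    qed
    then have 1: "excess C \<ge> 3 * int (card ?S) - 2"
      using attached_hoods[OF CY(3), of ?S] fin W(2) sepW CY(2) by auto
    have "C \<noteq> {}" using CY(2) by auto
    then have "card C \<ge> 5" using critical_large[of C] CY by simp
    then have "slack C + slack (V - C) \<ge> 4" using cut[OF CY(3)] big[OF CY(1)] by simp
    then have 2: "excess C \<ge> 2" using excess_slack[OF CY(3)] CY(2) by simp
    have "excess C \<ge> int (card ?S)" using 1 2 by linarith
    then show ?thesis using sum_charge[OF fin(2) finC, of b] by simp
  qed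
  have single: "?wt y \<ge> 0" if y: "y \<in> Y - W" "y \<notin> \<Union>\<C>" for y
  proof -
    have "\<not> node G y" "y \<in> V" using y YV by (auto simp: W_def)
    then show ?thesis using charge_nonneg[of y W b] fin(2) W(2) sepW b by blast
  qed
  have maxC: "\<exists>D\<in>\<M>. C \<subseteq> D" if C: "C \<in> \<C>" for C
  proof -
    obtain D where "D \<in> \<C>" "C \<subseteq> D" "\<forall>D'\<in>\<C>. D \<subseteq> D' \<longrightarrow> D = D'"
      using finite_has_maximal2[OF fin(1) C] by auto
    then show ?thesis by (auto simp: \<M>_def)
  qed
  have "\<M> \<subseteq> \<C>" by (auto simp: \<M>_def)
  then have UM: "\<Union>\<M> = \<Union>\<C>" using maxC by blast
  have disjM: "C \<inter> D = {}" if CD: "C \<in> \<M>" "D \<in> \<M>" "C \<noteq> D" for C D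
  proof (rule ccontr)
    assume ne: "C \<inter> D \<noteq> {}"
    have CC: "C \<in> \<C>" "D \<in> \<C>" using CD by (auto simp: \<M>_def)
    then have "slack (C \<union> D) = 1"
      using critical_Un(1)[of C D] ne YV X(2) by (auto simp: \<C>_def)
    then have "C \<union> D \<in> \<C>" using CC by (auto simp: \<C>_def)
    then have "C = C \<union> D" "D = C \<union> D" using CD by (auto simp: \<M>_def)
    then show False using CD(3) by simp
  qed
  have UW: "\<Union>\<C> \<subseteq> Y - W" by (auto simp: \<C>_def W_def)
  have "(\<Sum>y\<in>\<Union>\<M>. ?wt y) = (\<Sum>C\<in>\<M>. \<Sum>y\<in>C. ?wt y)"
    using disjM finY by (subst sum.Union_disjoint) (auto simp: \<M>_def \<C>_def intro: finite_subset)
  also have "\<dots> \<ge> 0"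
    by (rule sum_nonneg, rule block) (simp add: \<M>_def)
  finally have "(\<Sum>y\<in>\<Union>\<C>. ?wt y) \<ge> 0" using UM by simp
  moreover have "(\<Sum>y\<in>(Y - W) - \<Union>\<C>. ?wt y) \<ge> 0" using single by (intro sum_nonneg) auto
  moreover have "(\<Sum>y\<in>Y - W. ?wt y) = (\<Sum>y\<in>(Y - W) - \<Union>\<C>. ?wt y) + (\<Sum>y\<in>\<Union>\<C>. ?wt y)"
    using UW finY by (intro sum.subset_diff) auto
  ultimately have "excess Y \<ge> 0" using exY by simp
  moreover have "slack Y + slack (V - Y) \<ge> 4" using cut[OF YV coY(2)] X5 by simp
  ultimately show False using excess_slack[OF YV] X(1) by simp
qed

lemma no_cocritical:
  assumes "cocritical L" "card L \<ge> 2"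
    and "\<And>S. S \<subseteq> V \<Longrightarrow> card S \<ge> 2 \<Longrightarrow> card (V - S) \<ge> 2 \<Longrightarrow> slack S + slack (V - S) \<ge> 4"
  shows False
  using min_cocritical_without_open[OF assms(1,2)] no_clean_min_cocritical assms(3) by metis

end
section \<open>Circuits without proper critical sets\<close>

lemma card4_extend:
  assumes "card S = 4" "{p, q, r} \<subseteq> S" "p \<noteq> q" "p \<noteq> r" "q \<noteq> r"
  obtains a where "S = {p, q, r, a}" "a \<notin> {p, q, r}"
proof -
  have "card (S - {p, q, r}) = 1" using assms by (subst card_Diff_subset) auto
  then obtain a where "S - {p, q, r} = {a}" by (auto simp: card_1_singleton_iff)
  then show thesis using that[of a] assms(2) by blast
qed

lemma (in simple_circuit) nbrs_eqI:
  assumes "V = S \<union> T" "S \<subseteq> nbrs a" "nbrs a \<inter> T = {}"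
  shows "nbrs a = S"
  using assms nbrs_sub[of a] by blast

lemma (in simple_circuit) nbrs_subI:
  assumes "V = S \<union> T" "nbrs a \<inter> T = {}"
  shows "nbrs a \<subseteq> S"
  using assms nbrs_sub[of a] by blast

text \<open>The second assumption is essential 5-edge-connectivity: the sum is the number of edges that leave \<open>S\<close>.\<close>

locale circuit_without_proper_critical = circuit_without_admissible +
  assumes no_proper: "\<not> (\<exists>X. proper_critical G X)"
    and cut5: "\<And>S. S \<subseteq> V \<Longrightarrow> card S \<ge> 2 \<Longrightarrow> card (V - S) \<ge> 2 \<Longrightarrow> slack S + slack (V - S) \<ge> 5"
begin

text \<open>Without proper critical sets the only critical sets are the complements of nodes.\<close>

lemma critical_big:
  assumes "X \<subseteq> V" "X \<noteq> V" "slack X = 1"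
  shows "card V \<le> card X + 1"
  using no_proper assms by (auto simp: proper_critical_def critical_iff_slack psubset_eq)

lemma node_clique:
  assumes "node G v"
  shows "clique_node v"
proof (rule ccontr)
  assume "\<not> clique_node v"
  then have o: "open_node v" using node_cases assms by blast
  obtain z where z: "z \<in> nbrs v" using nbrs3[OF assms] by (metis insertI1)
  obtain L where L: "arm v z L" using arm_exists[OF o z] by metis
  then have zL: "z \<in> L" "L \<subseteq> V" "v \<notin> L" by (auto simp: arm_def)
  then have "v \<noteq> z" by auto
  have vV: "v \<in> V" using assms by (simp add: node_iff)
  have "card V \<le> card (V - insert v L) + 1"
    using critical_big[of "V - insert v L"] L vV by (auto simp: arm_def)
  moreover have "card (V - insert v L) \<le> card (V - {v, z})"
    using zL by (intro card_mono) auto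
  moreover have "card (V - {v, z}) = card V - 2"
    using zL vV \<open>v \<noteq> z\<close> by (subst card_Diff_subset) auto
  ultimately show False using order_ge6[OF assms] by linarith
qed

lemma node_nbr: "node G v \<Longrightarrow> u \<in> nbrs v \<Longrightarrow> \<not> node G u"
  using clique_node_nbrs node_clique by blast

lemma last_vertex_node:
  assumes "X \<subseteq> V" "slack X = 1" "card V = card X + 1"
  obtains u where "node G u" "u \<notin> X" "V = insert u X"
proof -
  have "card (V - X) = 1" using assms finite_sub by (simp add: card_Diff_subset)
  then obtain u where u: "V - X = {u}" by (auto simp: card_1_singleton_iff)
  then have "V - {u} = X" "u \<in> V" using assms(1) by auto
  then have "node G u" using slack_remove[of u] assms(2) by (simp add: node_def)
  then show thesis using that u assms(1) by blast
qed

text \<open>The two cliques share a triangle and unite to a critical set with five vertices. It misses only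
  one vertex, which is a node with the same triangle as its neighbourhood.\<close>

lemma twin_nodes:
  assumes v: "node G v" and w: "node G w" and vw: "v \<noteq> w" "nbrs v = nbrs w"
  shows "card V = 6" "graph_iso G G57"
proof -
  obtain x y z where N: "nbrs v = {x, y, z}" "x \<noteq> y" "x \<noteq> z" "y \<noteq> z"
    using nbrs3[OF v] by metis
  have Nw: "nbrs w = {x, y, z}" using N vw by simp
  let ?U = "hood v \<union> hood w"
  have U: "?U = {v, w, x, y, z}" "hood v \<inter> hood w = {x, y, z}"
    using N Nw vw nbrs_irrefl[of v] nbrs_irrefl[of w] by (auto simp: hood_def)
  have d: "distinct [v, w, x, y, z]"
    using N Nw vw nbrs_irrefl[of v] nbrs_irrefl[of w] by auto
  have cv: "clique_node v" "clique_node w" using node_clique v w by auto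
  have "slack {x, y, z} = 3"
    using slack_hood_ge(2)[OF cv(1), of "{x, y, z}"] N by (auto simp: hood_def)
  then have "slack ?U \<le> 1"
    using slack_submodular[OF hood_V[OF v] hood_V[OF w]] slack_hood cv U(2) by simp
  moreover have cU: "card ?U = 5" unfolding U(1) using d by simp
  moreover have UV: "?U \<subseteq> V" using hood_V v w by simp
  moreover have "?U \<noteq> V" using cU order_ge6[OF v] by auto
  moreover have "slack ?U \<ge> 1" using UV \<open>?U \<noteq> V\<close> by (intro slack_pos) (auto simp: hood_def)
  ultimately have s: "slack ?U = 1" "card V \<le> 6" using critical_big[of ?U] by auto
  then show c6: "card V = 6" using order_ge6[OF v] by simp
  obtain u where u: "node G u" "u \<notin> ?U" "V = insert u ?U"
    using last_vertex_node[OF UV s(1)] c6 cU by auto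
  have "v \<notin> nbrs u" "w \<notin> nbrs u" using node_nbr[OF u(1)] v w by blast+
  have V: "V = {v, w, u, x, y, z}" using u(3) U(1) by auto
  have "nbrs u \<subseteq> {x, y, z}"
    by (rule nbrs_subI[where T = "{v, w, u}"]) (use V \<open>v \<notin> nbrs u\<close> \<open>w \<notin> nbrs u\<close> in auto)
  then have Nu: "nbrs u = {x, y, z}"
    using card_subset_eq[of "{x, y, z}" "nbrs u"] u(1) N by (simp add: node_iff)
  have "{v, w, u} \<subseteq> nbrs t" if "t \<in> {x, y, z}" for t
    using that N Nw Nu nbrs_sym[of _ t] by auto
  then have 1: "{v, w, u} \<subseteq> nbrs x" "{v, w, u} \<subseteq> nbrs y" "{v, w, u} \<subseteq> nbrs z" by auto
  have 2: "b \<in> nbrs a" if "a \<in> {x, y, z}" "b \<in> {x, y, z}" "a \<noteq> b" for a b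
    using hood_adj[OF cv(1), of a b] that N by (auto simp: hood_def)
  show "graph_iso G G57"
  proof (rule iso_G57[OF V])
    show "distinct [v, w, u, x, y, z]" using d u(2) U(1) by auto
    show "nbrs x = {v, w, u, y, z}"
      by (rule nbrs_eqI[where T = "{x}"]) (use V 1(1) 2[of x y] 2[of x z] N in auto)
    show "nbrs y = {v, w, u, x, z}"
      by (rule nbrs_eqI[where T = "{y}"]) (use V 1(2) 2[of y x] 2[of y z] N in auto)
    show "nbrs z = {v, w, u, x, y}"
      by (rule nbrs_eqI[where T = "{z}"]) (use V 1(3) 2[of z y] 2[of z x] N in auto)
  qed (use N Nw Nu in auto)
qed

text \<open>The two cliques share the edge \<open>xy\<close> and cover six vertices with slack at most 1. If they cover
  the graph, one more edge is needed to reach slack 0, and it can only join \<open>z\<close> and \<open>z'\<close>. Otherwise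
  one vertex \<open>u\<close> is missing and is a node whose clique omits \<open>z\<close> or \<open>z'\<close>; then \<open>u\<close> has the same
  neighbours as \<open>v\<close> or \<open>w\<close>, which happens only on six vertices.\<close>

lemma near_twin_nodes:
  assumes v: "node G v" and w: "node G w" and vw: "v \<noteq> w"
    and two: "card (hood v \<inter> hood w) = 2"
  shows "graph_iso G G59"
proof -
  have cv: "clique_node v" "clique_node w" using node_clique v w by auto
  have nadj: "w \<notin> nbrs v" "v \<notin> nbrs w" using node_nbr v w by auto
  then have I: "hood v \<inter> hood w = nbrs v \<inter> nbrs w" using vw by (auto simp: hood_def)
  then obtain x y where xy: "nbrs v \<inter> nbrs w = {x, y}" "x \<noteq> y" using two by (auto simp: card_2_iff)
  obtain z where N: "nbrs v = {x, y, z}" "x \<noteq> z" "y \<noteq> z"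
    using nbrs3_at2[OF v, of x y] xy by auto
  obtain z' where N': "nbrs w = {x, y, z'}" "x \<noteq> z'" "y \<noteq> z'"
    using nbrs3_at2[OF w, of x y] xy by auto
  have zz: "z \<noteq> z'" using xy N N' by auto
  have d: "distinct [z', v, w, z, x, y]"
    using N N' xy(2) zz vw nadj nbrs_irrefl[of v] nbrs_irrefl[of w] by auto
  let ?U = "hood v \<union> hood w" and ?C = "cross (hood v) (hood w)"
  have U: "?U = {z', v, w, z, x, y}" using N N' by (auto simp: hood_def)
  have h: "hood v = {v, x, y, z}" "hood w = {w, x, y, z'}" using N N' by (auto simp: hood_def)
  have cU: "card ?U = 6" unfolding U using d by simp
  have UV: "?U \<subseteq> V" using hood_V v w by simp
  have "slack (hood v \<inter> hood w) = 3"
    using slack_hood_ge(2)[OF cv(1), of "hood v \<inter> hood w"] two by simp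
  then have sU: "slack ?U + int (card ?C) = 1"
    using slack_modular[OF hood_V[OF v] hood_V[OF w]] slack_hood cv by simp
  have adj: "b \<in> nbrs a" if "a \<in> hood v \<and> b \<in> hood v \<or> a \<in> hood w \<and> b \<in> hood w" "a \<noteq> b" for a b
    using hood_adj[OF cv(1), of a b] hood_adj[OF cv(2), of a b] that by blast
  show ?thesis
  proof (cases "?U = V")
    case True
    then have "card ?C = 1" using sU by simp
    then obtain e where e: "e \<in> ?C" by fastforce
    then have "e \<in> E" by (simp add: cross_def)
    then obtain a b where ab: "e = {a, b}" "b \<in> nbrs a" "a \<in> nbrs b" using edge_endpoints by metis
    then have "(a = z \<and> b = z') \<or> (a = z' \<and> b = z)"
      using e h N N' nadj d nbrs_sym[of z' v] nbrs_sym[of z w]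
      by (auto simp: cross_def)
    then have zz': "z' \<in> nbrs z" "z \<in> nbrs z'" using ab by auto
    have nz: "w \<notin> nbrs z" "v \<notin> nbrs z'" using N N' d nbrs_sym[of w z] nbrs_sym[of v z'] by auto
    have V: "V = {z', v, w, z, x, y}" using True U by simp
    show ?thesis
    proof (rule iso_G59[OF V d])
      show "nbrs v = {z, x, y}" "nbrs w = {z', x, y}" using N N' by auto
      show "nbrs z' = {w, z, x, y}"
      proof (rule nbrs_eqI[where T = "{z', v}"])
        show "{w, z, x, y} \<subseteq> nbrs z'"
          using zz' adj[of z' w] adj[of z' z] adj[of z' x] adj[of z' y] h d by auto
      qed (use V nz in auto)
      show "nbrs z = {z', v, x, y}"
      proof (rule nbrs_eqI[where T = "{z, w}"])
        show "{z', v, x, y} \<subseteq> nbrs z"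
          using zz' adj[of z z'] adj[of z v] adj[of z x] adj[of z y] h d by auto
      qed (use V nz in auto)
      show "nbrs x = {z', v, w, z, y}"
      proof (rule nbrs_eqI[where T = "{x}"])
        show "{z', v, w, z, y} \<subseteq> nbrs x"
          using adj[of x z'] adj[of x v] adj[of x w] adj[of x z] adj[of x y] h d by auto
      qed (use V in auto)
      show "nbrs y = {z', v, w, z, x}"
      proof (rule nbrs_eqI[where T = "{y}"])
        show "{z', v, w, z, x} \<subseteq> nbrs y"
          using adj[of y z'] adj[of y v] adj[of y w] adj[of y z] adj[of y x] h d by auto
      qed (use V in auto)
    qed
  next
    case False
    have "slack ?U \<ge> 1" using UV False by (intro slack_pos) (auto simp: hood_def)
    then have s: "slack ?U = 1 \<and> card ?C = 0" using sU by linarith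
    then have C: "?C = {}" by auto
    have "card V \<le> 7" using critical_big[OF UV False] s cU by simp
    moreover have "card V > 6" using psubset_card_mono[of V ?U] UV False cU by auto
    ultimately have c7: "card V = 7" by simp
    obtain u where u: "node G u" "u \<notin> ?U" "V = insert u ?U"
      using last_vertex_node[OF UV] s c7 cU by auto
    have "v \<notin> nbrs u" "w \<notin> nbrs u" using node_nbr[OF u(1)] v w by blast+
    then have sub: "nbrs u \<subseteq> {x, y, z, z'}"
      by (intro nbrs_subI[where T = "{v, w, u}"]) (use u(3) U in auto)
    have "z' \<notin> nbrs z"
    proof
      assume "z' \<in> nbrs z"
      then have "{z, z'} \<in> ?C" using h d by (auto simp: cross_def nbrs_def)
      then show False using C by simp
    qed
    then have "\<not> (z \<in> nbrs u \<and> z' \<in> nbrs u)"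
      using node_clique[OF u(1)] zz by (auto simp: clique_node_def)
    then have "nbrs u \<subseteq> nbrs v \<or> nbrs u \<subseteq> nbrs w" using sub N N' by auto
    then have "nbrs u = nbrs v \<or> nbrs u = nbrs w"
      using u(1) v w card_subset_eq[of "nbrs v" "nbrs u"] card_subset_eq[of "nbrs w" "nbrs u"]
      by (auto simp: node_iff)
    moreover have "u \<noteq> v" "u \<noteq> w" using u(2) by (auto simp: hood_def)
    ultimately have "card V = 6" using twin_nodes(1)[OF u(1)] v w by blast
    then show ?thesis using c7 by simp
  qed
qed

lemma hoods_meet_once:
  assumes v: "node G v" and w: "node G w" and vw: "v \<noteq> w"
    and no_iso: "\<not> graph_iso G G57" "\<not> graph_iso G G59"
  shows "card (hood v \<inter> hood w) \<le> 1"
proof -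
  have "w \<notin> nbrs v" "v \<notin> nbrs w" using node_nbr v w by auto
  then have I: "hood v \<inter> hood w = nbrs v \<inter> nbrs w" using vw by (auto simp: hood_def)
  have 3: "card (nbrs v) = 3" "card (nbrs w) = 3" using v w by (auto simp: node_iff)
  have "card (nbrs v \<inter> nbrs w) \<noteq> 3"
  proof
    assume "card (nbrs v \<inter> nbrs w) = 3"
    then have "nbrs v \<inter> nbrs w = nbrs v" "nbrs v \<inter> nbrs w = nbrs w"
      using 3 card_subset_eq[of "nbrs v" "nbrs v \<inter> nbrs w"] card_subset_eq[of "nbrs w" "nbrs v \<inter> nbrs w"]
      by auto
    then show False using twin_nodes(2)[OF v w vw] no_iso by simp
  qed
  moreover have "card (nbrs v \<inter> nbrs w) \<le> 3"
    using 3 card_mono[of "nbrs v" "nbrs v \<inter> nbrs w"] by simp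
  moreover have "card (nbrs v \<inter> nbrs w) \<noteq> 2"
    using near_twin_nodes[OF v w vw] no_iso I by auto
  ultimately show ?thesis unfolding I by linarith
qed

text \<open>The degrees make the excess of the union \<open>U\<close> of the two cliques 0, so \<open>U\<close> and its complement have
  equal slack, at most 2, and at most four edges leave \<open>U\<close>. Hence at most one vertex \<open>u\<close> is
  missing. If there is one, then the complement has slack 2, no edge joins the two cliques away
  from \<open>x\<close>, and \<open>{x, u}\<close> separates the graph. Otherwise the degrees 4 force a perfect matching
  between \<open>{y, z}\<close> and \<open>{y', z'}\<close>.\<close>

lemma touching_pair_G312:
  assumes v: "node G v" and w: "node G w"
    and Nv: "nbrs v = {x, y, z}" and Nw: "nbrs w = {x, y', z'}"
    and one: "card (hood v \<inter> hood w) \<le> 1"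
    and deg: "degree G x = 6" "degree G y = 4" "degree G z = 4" "degree G y' = 4" "degree G z' = 4"
  shows "graph_iso G G312"
proof -
  have cv: "clique_node v" "clique_node w" using node_clique v w by auto
  have h: "hood v = {v, x, y, z}" "hood w = {w, x, y', z'}" using Nv Nw by (auto simp: hood_def)
  have "x \<in> hood v \<inter> hood w" using h by simp
  then have I: "hood v \<inter> hood w = {x}" using one by (intro card_le1_eq_singleton) auto
  have dv: "distinct [v, x, y, z]" "distinct [w, x, y', z']"
    using card_hood[OF v] card_hood[OF w] unfolding h by (auto simp: card_insert_if split: if_splits)
  have apart: "s \<noteq> t" if "s \<in> {v, y, z}" "t \<in> {w, y', z'}" for s t
  proof
    assume "s = t"
    then have "s \<in> hood v \<inter> hood w" using that h by auto
    then have "s = x" using I by simp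
    then show False using that(1) dv(1) by auto
  qed
  have d: "distinct [x, v, y, z, w, y', z']"
    using dv apart[of v w] apart[of v y'] apart[of v z'] apart[of y w] apart[of y y'] apart[of y z']
      apart[of z w] apart[of z y'] apart[of z z'] by auto
  let ?U = "hood v \<union> hood w" and ?C = "cross (hood v) (hood w)"
  have U: "?U = {x, v, y, z, w, y', z'}" using h by auto
  have UV: "?U \<subseteq> V" using hood_V v w by simp
  have cU: "card ?U = 7" unfolding U using d by simp
  have sU: "slack ?U + int (card ?C) = 2"
    using slack_modular[OF hood_V[OF v] hood_V[OF w]] slack_hood cv I by simp
  have "degree G v = 3" "degree G w = 3" using v w by (auto simp: node_def)
  then have "excess ?U = 0" unfolding U excess_def using d deg by simp
  then have bal: "slack (V - ?U) = slack ?U" using excess_slack[OF UV] by simp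
  have adj: "b \<in> nbrs a" if "a \<in> hood v \<and> b \<in> hood v \<or> a \<in> hood w \<and> b \<in> hood w" "a \<noteq> b" for a b
    using hood_adj[OF cv(1), of a b] hood_adj[OF cv(2), of a b] that by blast
  have "card (V - ?U) < 2"
    using cut5[OF UV] cU bal sU by linarith
  then consider "V = ?U" | "card (V - ?U) = 1" using UV
    by (metis Diff_eq_empty_iff One_nat_def card_0_eq finite_Diff finite_V less_2_cases subset_antisym)
  then show ?thesis
  proof cases
    case 2
    then obtain u where u: "V - ?U = {u}" by (auto simp: card_1_singleton_iff)
    then have "slack ?U = 2" using bal by simp
    then have C: "?C = {}" using sU by simp
    have "V = {v, y, z} \<union> {x, u}"
    proof (rule no_small_separator)
      show "{v, y, z} \<subseteq> V" "{x, u} \<subseteq> V" using UV U u by auto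
      show "{v, y, z} \<inter> {x, u} = {}" using d u U by auto
      show "nbrs s \<subseteq> {v, y, z} \<union> {x, u}" if s: "s \<in> {v, y, z}" for s
      proof
        fix t assume t: "t \<in> nbrs s"
        show "t \<in> {v, y, z} \<union> {x, u}"
        proof (rule ccontr)
          assume n: "t \<notin> {v, y, z} \<union> {x, u}"
          have "t \<in> V" using t nbrs_V by auto
          then have "t \<in> {w, y', z'}" using n u U by auto
          then have "{s, t} \<in> ?C" using s t h d by (auto simp: cross_def nbrs_def)
          then show False using C by simp
        qed
      qed
    qed (auto simp: card_insert_if)
    then have "card V \<le> 5" by (simp add: card_insert_if)
    then show ?thesis using order_ge6[OF v] by simp
  next
    case 1
    then have V: "V = {x, v, y, z, w, y', z'}" using U by simp
    have far: "\<exists>b\<in>{y', z'}. nbrs a = {v, x, a', b}"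
      if a: "a \<in> {y, z}" "a' \<in> {y, z}" "a \<noteq> a'" for a a'
    proof -
      have c4: "card (nbrs a) = 4" using a deg degree_nbrs by auto
      have "{v, x, a'} \<subseteq> nbrs a" using adj[of a v] adj[of a x] adj[of a a'] a h d by auto
      then obtain b where b: "nbrs a = {v, x, a', b}" "b \<notin> {v, x, a'}"
        using card4_extend[OF c4, of v x a'] a d by auto
      have "b \<in> V" "b \<noteq> a" using b nbrs_sub[of a] nbrs_irrefl[of a] by auto
      moreover have "b \<noteq> w" using nbrs_sym[of w a] Nw b a d by auto
      ultimately have "b \<in> {y', z'}" using V b a by auto
      then show ?thesis using b by blast
    qed
    obtain b where b: "b \<in> {y', z'}" "nbrs y = {v, x, z, b}" using far[of y z] d by auto
    obtain c where c: "c \<in> {y', z'}" "nbrs z = {v, x, y, c}" using far[of z y] d by auto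
    have near: "nbrs t = {w, x, t', s}"
      if t: "t \<in> {y', z'}" "t' \<in> {y', z'}" "t \<noteq> t'" "t \<in> nbrs s" "s \<in> {y, z}" for t t' s
    proof -
      have c4: "card (nbrs t) = 4" using t deg degree_nbrs by auto
      have "{w, x, t', s} \<subseteq> nbrs t"
        using adj[of t w] adj[of t x] adj[of t t'] t h d nbrs_sym[of s t] by auto
      moreover have "card {w, x, t', s} = 4" using t d by auto
      ultimately show ?thesis using card_subset_eq[of "nbrs t" "{w, x, t', s}"] c4 by simp
    qed
    have bc: "b \<noteq> c"
    proof
      assume eq: "b = c"
      define b' where "b' = (if b = y' then z' else y')"
      have b': "b' \<in> {y', z'}" "b \<noteq> b'" using b d by (auto simp: b'_def)
      have "b \<in> nbrs y" "b \<in> nbrs z" using b c eq by auto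
      then have "nbrs b = {w, x, b', y}" "nbrs b = {w, x, b', z}"
        using near[OF b(1) b'(1,2)] by auto
      then have "z \<in> {w, x, b', y}" by auto
      then show False using d b' by auto
    qed
    have Nb: "nbrs b = {w, x, c, y}" "nbrs c = {w, x, b, z}"
      using near[of b c y] near[of c b z] b c bc by auto
    have V': "V = {x, v, y, z, w, b, c}" using V b c bc by auto
    show ?thesis
    proof (rule iso_G312[OF V'])
      show "distinct [x, v, y, z, w, b, c]" using d b(1) c(1) bc by auto
      show "nbrs w = {x, b, c}" using Nw b c bc by auto
      show "nbrs x = {v, y, z, w, b, c}"
      proof (rule nbrs_eqI[where T = "{x}"])
        show "{v, y, z, w, b, c} \<subseteq> nbrs x"
          using adj[of x v] adj[of x y] adj[of x z] adj[of x w] adj[of x b] adj[of x c] h d b(1) c(1) by auto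
      qed (use V' in auto)
    qed (use Nv b c Nb in auto)
  qed
qed

text \<open>The excess of \<open>V\<close> is 0, so all charges vanish. If \<open>f\<close> nodes send their deficit to \<open>x\<close>, then
  \<open>deg x = f + 4\<close>, while \<open>deg x\<close> is at least three times the number of adjacent nodes. So \<open>f\<close> is at
  most 2, and a vertex with \<open>f \<ge> 1\<close> is adjacent to no node other than its donors. Hence the
  neighbours of a node that do not receive its deficit have degree 4, and since the neighbours
  have total excess at least 2, the recipient has degree 6 and a second donor.\<close>

lemma exceptional:
  assumes "node G u0"
  shows "graph_iso G G57 \<or> graph_iso G G59 \<or> graph_iso G G312"
proof (rule ccontr)
  assume "\<not> ?thesis"
  then have no: "\<not> graph_iso G G57" "\<not> graph_iso G G59" "\<not> graph_iso G G312" by auto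
  define W where "W = {v \<in> V. node G v}"
  have W: "finite W" "W \<subseteq> V" by (auto simp: W_def)
  have nW: "node G v" "clique_node v" if "v \<in> W" for v using that node_clique by (auto simp: W_def)
  have sep: "card (hood v \<inter> hood w) \<le> 1" if "v \<in> W" "w \<in> W" "v \<noteq> w" for v w
    using hoods_meet_once[OF nW(1) nW(1)] that no by blast
  have cut: "slack (hood v) + slack (V - hood v) \<ge> 5" if "v \<in> W" for v
  proof (rule cut5)
    have v: "node G v" using nW(1) that .
    show "hood v \<subseteq> V" "card (hood v) \<ge> 2" using hood_V card_hood v by auto
    show "card (V - hood v) \<ge> 2"
      using hood_V[OF v] card_hood[OF v] order_ge6[OF v] by (simp add: card_Diff_subset)
  qed
  have "\<exists>x. x \<in> nbrs v \<and> degree G x \<ge> 5" if "v \<in> W" for v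
    using heavy_nbr[OF nW(2)[OF that]] cut[OF that] by simp
  then obtain b where b: "\<And>v. v \<in> W \<Longrightarrow> b v \<in> nbrs v \<and> degree G (b v) \<ge> 5" by metis
  have bV: "b v \<in> V - W" if "v \<in> W" for v
    using b[OF that] nbrs_V[of "b v" v] by (auto simp: W_def node_def)
  have "(\<Sum>y\<in>V - W. charge W b y) = 0"
    using excess_charge[of V W b] excess_slack[of V] W nW(1) bV by simp
  moreover have "charge W b y \<ge> 0" if "y \<in> V - W" for y
    using charge_nonneg[of y W b] that W(1) nW(2) sep b by (auto simp: W_def)
  ultimately have "\<forall>y\<in>V - W. charge W b y = 0"
    by (subst sum_nonneg_eq_0_iff[symmetric]) auto
  then have fib: "int (degree G y) - 4 = int (card {v \<in> W. b v = y})" if "y \<in> V - W" for y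
    using that by (simp add: charge_def)
  have att: "int (degree G y) \<ge> 3 * int (card S)"
    if "S \<subseteq> W" "\<And>v. v \<in> S \<Longrightarrow> y \<in> nbrs v" "y \<in> V" for y S
    using attached_degree[of y S] that nW(2) sep finite_subset[OF that(1) W(1)] by blast
  have nbrV: "x \<in> V - W" if "v \<in> W" "x \<in> nbrs v" for v x
    using node_nbr[OF nW(1)[OF that(1)] that(2)] nbrs_V[OF that(2)] by (auto simp: W_def)
  have four: "degree G x = 4" if v: "v \<in> W" and x: "x \<in> nbrs v" "x \<noteq> b v" for v x
  proof (rule ccontr)
    assume ne: "degree G x \<noteq> 4"
    let ?F = "{v \<in> W. b v = x}"
    have xV: "x \<in> V - W" using nbrV v x by blast
    then have "degree G x \<ge> 4" using degree_ge4 by (auto simp: W_def)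
    then have F: "card ?F \<ge> 1" using fib[OF xV] ne by linarith
    have "v \<notin> ?F" using x by auto
    then have cF: "card (insert v ?F) = card ?F + 1" using W(1) by simp
    have "int (degree G x) \<ge> 3 * int (card (insert v ?F))"
      using v x b xV by (intro att) auto
    then show False using fib[OF xV] cF F by linarith
  qed
  have W0: "u0 \<in> W" using assms by (simp add: W_def node_iff)
  let ?x = "b u0"
  have x: "?x \<in> nbrs u0" "?x \<in> V - W" using b W0 bV by auto
  obtain y z where N: "nbrs u0 = {?x, y, z}" "?x \<noteq> y" "?x \<noteq> z" "y \<noteq> z"
    using nbrs3_at[OF assms x(1)] by metis
  have yz: "degree G y = 4" "degree G z = 4" using four[OF W0] N by auto
  have "(\<Sum>t\<in>nbrs u0. int (degree G t) - 4) \<ge> 2"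
    using hood_excess[OF nW(2)[OF W0], of 5] cut[OF W0] by simp
  then have ge: "int (degree G ?x) - 4 \<ge> 2" using N yz by simp
  let ?F = "{v \<in> W. b v = ?x}"
  have "int (degree G ?x) \<ge> 3 * int (card ?F)"
  proof (rule att)
    show "?x \<in> nbrs v" if "v \<in> ?F" for v using b[of v] that by auto
  qed (use x in auto)
  then have six: "degree G ?x = 6" "card ?F = 2" using fib[OF x(2)] ge by linarith+
  have "u0 \<in> ?F" using W0 by simp
  moreover obtain p q where "?F = {p, q}" "p \<noteq> q" using six(2) by (auto simp: card_2_iff)
  ultimately obtain w where w: "w \<in> ?F" "w \<noteq> u0" by auto
  then have wW: "w \<in> W" "b w = ?x" by auto
  have "?x \<in> nbrs w" using b[OF wW(1)] wW(2) by simp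
  then obtain y' z' where N': "nbrs w = {?x, y', z'}" "?x \<noteq> y'" "?x \<noteq> z'" "y' \<noteq> z'"
    using nbrs3_at[OF nW(1)[OF wW(1)]] by metis
  have "degree G y' = 4" "degree G z' = 4" using four[OF wW(1)] N' wW(2) by auto
  then have "graph_iso G G312"
    using touching_pair_G312[OF assms nW(1)[OF wW(1)] N(1) N'(1)] sep[OF W0 wW(1)] w(2) six(1) yz
    by auto
  then show False using no by simp
qed

end

lemma (in three_connected_circuit) node_exists:
  assumes "min_degree G = 3"
  obtains v where "node G v"
proof -
  have "V \<noteq> {}" using three_connected by (auto simp: k_connected_def)
  then have "Min (degree G ` V) \<in> degree G ` V" by (intro Min_in) auto
  then show thesis using that assms by (auto simp: min_degree_def node_def)
qed

theorem theorem1p3: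
  fixes G :: "'a ugraph"
  assumes "simple_circuit21 G"
    and "k_connected 3 G"
    and "min_degree G = 3"
    and "\<forall>H \<in> exceptional_graphs. \<not> graph_iso G H"
    and "(essentially_edge_connected 5 G \<and> \<not> (\<exists>X. proper_critical G X)) \<or>
         (essentially_edge_connected 4 G \<and> (\<exists>X. proper_critical G X))"
  shows "\<exists>v. admissible G v"
proof (rule ccontr)
  assume "\<not> ?thesis"
  then interpret circuit_without_admissible G using assms by unfold_locales auto
  obtain u where u: "node G u" using node_exists assms by blast
  have low: "slack S + slack (V - S) \<ge> 3" if "S \<subseteq> V" "card S \<ge> 2" "card (V - S) \<ge> 2" for S
    using slack_pair_cut[of S] that by (metis Diff_cancel card.empty not_numeral_le_zero)
  from assms(5) show False
  proof (elim disjE conjE)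
    assume ess: "essentially_edge_connected 4 G" and "\<exists>X. proper_critical G X"
    then obtain X where X: "X \<subset> V" "slack X = 1" "card X + 1 < card V"
      by (auto simp: proper_critical_def critical_iff_slack)
    have "cocritical (V - X)" using X by (auto simp: cocritical_def double_diff)
    moreover have "card (V - X) \<ge> 2" using X finite_sub[of X] by (simp add: card_Diff_subset)
    moreover have "slack S + slack (V - S) \<ge> 4" if "S \<subseteq> V" "card S \<ge> 2" "card (V - S) \<ge> 2" for S
      using low[OF that] essential_cut[of 3 S] ess that by simp
    ultimately show False using no_cocritical by blast
  next
    assume ess: "essentially_edge_connected 5 G" and np: "\<not> (\<exists>X. proper_critical G X)"
    have two: "slack S \<ge> 2" if S: "S \<subseteq> V" "card S \<ge> 2" "card (V - S) \<ge> 2" for S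
    proof -
      have "S \<noteq> {}" "S \<noteq> V" using S by auto
      then have "slack S \<ge> 1" using slack_pos S by blast
      moreover have "card S + 1 < card V" using S finite_sub[of S] by (simp add: card_Diff_subset)
      then have "slack S \<noteq> 1" using np S(1) \<open>S \<noteq> V\<close>
        by (auto simp: proper_critical_def critical_iff_slack)
      ultimately show ?thesis by linarith
    qed
    have "slack S + slack (V - S) \<ge> 5" if S: "S \<subseteq> V" "card S \<ge> 2" "card (V - S) \<ge> 2" for S
    proof -
      have "V - (V - S) = S" using S by auto
      then show ?thesis
        using two[OF S] two[of "V - S"] S essential_cut[of 4 S] ess by simp
    qed
    then interpret circuit_without_proper_critical G using np by unfold_locales auto
    show False using exceptional[OF u] assms(4) by (auto simp: exceptional_graphs_def)
  qed
qed

end
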